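(* The following two optimization problems are polynomial-time equivalent (each can be reduced to the other in polynomial time). (1) Blocking optimal $k$-union-arborescences: given a digraph $D_1=(V_1,A_1)$, a positive integer $k$, a cost function $c_1:A_1\to\mathbb{R}$ and a weight function $w_1:A_1\to\mathbb{R}_+$, find $H\subseteq A_1$ such that $H$ intersects every minimum $c_1$-cost $k$-union-arborescence of $D_1$ and $w_1(H)$ is minimum. (2) Blocking optimal $k$-union-$r$-arborescences: given a digraph $D_2=(V_2,A_2)$, a node $r\in V_2$, a positive integer $k$, a cost function $c_2:A_2\to\mathbb{R}$ and a weight function $w_2:A_2\to\mathbb{R}_+$, find $H\subseteq A_2$ such that $H$ intersects every minimum $c_2$-cost $k$-union-$r$-arborescence of $D_2$ and $w_2(H)$ is minimum.
   Context: Digraphs may have parallel arcs. A spanning arborescence (rooted at $r$, an $r$-arborescence) of a digraph $D=(V,A)$ is an arc set $B\subseteq A$ containing no cycle such that $r$ has in-degree $0$ in $B$ and every $v\in V-r$ has in-degree exactly $1$ in $B$. A $k$-union-arborescence is an arc set that is the disjoint union of $k$ spanning arborescences (whose roots may differ); a $k$-union-$r$-arborescence is the disjoint union of $k$ spanning $r$-arborescences. The cost of an arc set is the sum of the costs of its arcs, and $w(H)=\sum_{a\in H}w(a)$. "$H$ intersects $B$" means $H\cap B\neq\emptyset$. *)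

theory Defs
  imports
    "Graph_Theory.Arc_Walk"
    "HOL-Library.Disjoint_Sets"
    "HOL-Computational_Algebra.Polynomial"
begin

section \<open>Unions of arborescences and blocking sets\<close>

definition spanning_arborescence :: "('a, 'b) pre_digraph \<Rightarrow> 'a \<Rightarrow> 'b set \<Rightarrow> bool" where
  "spanning_arborescence G r B \<longleftrightarrow>
     r \<in> verts G \<and> B \<subseteq> arcs G \<and>
     (\<nexists>p. pre_digraph.cycle (G\<lparr>arcs := B\<rparr>) p) \<and>
     in_degree (G\<lparr>arcs := B\<rparr>) r = 0 \<and>
     (\<forall>v \<in> verts G - {r}. in_degree (G\<lparr>arcs := B\<rparr>) v = 1)"

definition union_arborescence :: "('a, 'b) pre_digraph \<Rightarrow> nat \<Rightarrow> 'b set \<Rightarrow> bool" where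
  "union_arborescence G k B \<longleftrightarrow>
     (\<exists>F. (\<forall>i<k. \<exists>r. spanning_arborescence G r (F i)) \<and>
          disjoint_family_on F {..<k} \<and> B = (\<Union>i<k. F i))"

definition union_r_arborescence :: "('a, 'b) pre_digraph \<Rightarrow> 'a \<Rightarrow> nat \<Rightarrow> 'b set \<Rightarrow> bool" where
  "union_r_arborescence G r k B \<longleftrightarrow>
     (\<exists>F. (\<forall>i<k. spanning_arborescence G r (F i)) \<and>
          disjoint_family_on F {..<k} \<and> B = (\<Union>i<k. F i))"

definition min_cost :: "('b \<Rightarrow> real) \<Rightarrow> ('b set \<Rightarrow> bool) \<Rightarrow> 'b set \<Rightarrow> bool" where
  "min_cost c P B \<longleftrightarrow> P B \<and> (\<forall>B'. P B' \<longrightarrow> sum c B \<le> sum c B')"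

definition blocks_optimal ::
  "('a, 'b) pre_digraph \<Rightarrow> ('b \<Rightarrow> real) \<Rightarrow> ('b set \<Rightarrow> bool) \<Rightarrow> 'b set \<Rightarrow> bool" where
  "blocks_optimal G c P H \<longleftrightarrow> H \<subseteq> arcs G \<and> (\<forall>B. min_cost c P B \<longrightarrow> H \<inter> B \<noteq> {})"

section \<open>Oracle programs\<close>

text \<open>
  Since costs and weights are real numbers, the model of computation is a real-number
  machine: programs of a WHILE language in the style of N. D. Jones whose values are binary
  trees with real numbers as leaves. A number occupies one cell. The only operations on numbers
  are addition, subtraction and comparison, and the only numeric literals are integers; hence
  on rational input the bit lengths of all numbers stay polynomial whenever the number of steps
  does, so that a polynomial number of steps also means polynomial time on a Turing machine.
  Trees are immutable and handled by reference, so each operation takes constant time; there is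
  no operation comparing whole trees.
\<close>

datatype data = Null | Num real | Node data data

fun data_size :: "data \<Rightarrow> nat" where
  "data_size Null = 1"
| "data_size (Num x) = 1"
| "data_size (Node a b) = 1 + data_size a + data_size b"

type_synonym store = "nat \<Rightarrow> data"

datatype exp =
    Var nat
  | Empty
  | Lit int
  | Join exp exp
  | Fst exp
  | Snd exp
  | Plus exp exp
  | Minus exp exp
  | LessEq exp exp
  | IsNum exp

text \<open>\<^const>\<open>Null\<close> is the truth value ``false''; every other value counts as ``true''.\<close>

fun eval :: "exp \<Rightarrow> store \<Rightarrow> data" where
  "eval (Var x) s = s x"
| "eval Empty s = Null"
| "eval (Lit i) s = Num (of_int i)"
| "eval (Join e1 e2) s = Node (eval e1 s) (eval e2 s)"
| "eval (Fst e) s = (case eval e s of Node a b \<Rightarrow> a | _ \<Rightarrow> Null)"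
| "eval (Snd e) s = (case eval e s of Node a b \<Rightarrow> b | _ \<Rightarrow> Null)"
| "eval (Plus e1 e2) s =
     (case (eval e1 s, eval e2 s) of (Num a, Num b) \<Rightarrow> Num (a + b) | _ \<Rightarrow> Null)"
| "eval (Minus e1 e2) s =
     (case (eval e1 s, eval e2 s) of (Num a, Num b) \<Rightarrow> Num (a - b) | _ \<Rightarrow> Null)"
| "eval (LessEq e1 e2) s =
     (case (eval e1 s, eval e2 s) of (Num a, Num b) \<Rightarrow> (if a \<le> b then Num 1 else Null) | _ \<Rightarrow> Null)"
| "eval (IsNum e) s = (case eval e s of Num a \<Rightarrow> Num 1 | _ \<Rightarrow> Null)"

datatype com =
    Skip
  | Assign nat exp
  | Seq com com
  | If exp com com
  | While exp com
  | Query nat exp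

text \<open>
  \<open>exec f c s t s'\<close>: with oracle \<open>f\<close>, program \<open>c\<close> started in store \<open>s\<close> stops in store \<open>s'\<close> after
  time \<open>t\<close>. Evaluating an expression costs one unit, as the expressions of a fixed program have
  bounded size. An oracle call is charged the size of the query as a tree, i.e. the cost
  of writing it out without sharing of subtrees.
\<close>

inductive exec :: "(data \<Rightarrow> data) \<Rightarrow> com \<Rightarrow> store \<Rightarrow> nat \<Rightarrow> store \<Rightarrow> bool" for f where
  Skip: "exec f Skip s 1 s"
| Assign: "exec f (Assign x e) s 1 (s(x := eval e s))"
| Seq: "exec f c1 s t1 s1 \<Longrightarrow> exec f c2 s1 t2 s2 \<Longrightarrow> exec f (Seq c1 c2) s (t1 + t2) s2"
| IfTrue: "eval e s \<noteq> Null \<Longrightarrow> exec f c1 s t s' \<Longrightarrow> exec f (If e c1 c2) s (1 + t) s'"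
| IfFalse: "eval e s = Null \<Longrightarrow> exec f c2 s t s' \<Longrightarrow> exec f (If e c1 c2) s (1 + t) s'"
| WhileFalse: "eval e s = Null \<Longrightarrow> exec f (While e c) s 1 s"
| WhileTrue: "eval e s \<noteq> Null \<Longrightarrow> exec f c s t1 s1 \<Longrightarrow> exec f (While e c) s1 t2 s2
    \<Longrightarrow> exec f (While e c) s (1 + t1 + t2) s2"
| Query: "exec f (Query x e) s (1 + data_size (eval e s)) (s(x := f (eval e s)))"

definition computes_within :: "(data \<Rightarrow> data) \<Rightarrow> com \<Rightarrow> data \<Rightarrow> nat \<Rightarrow> data \<Rightarrow> bool" where
  "computes_within f c d T y \<longleftrightarrow>
     (\<exists>t s'. exec f c ((\<lambda>_. Null)(0 := d)) t s' \<and> t \<le> T \<and> s' 0 = y)"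

section \<open>Optimization problems and polynomial-time reductions\<close>

fun enc_list :: "data list \<Rightarrow> data" where
  "enc_list [] = Null"
| "enc_list (x # xs) = Node x (enc_list xs)"

definition enc_nat :: "nat \<Rightarrow> data" where
  "enc_nat n = Num (real n)"

definition encodes_set :: "nat set \<Rightarrow> data \<Rightarrow> bool" where
  "encodes_set S d \<longleftrightarrow> (\<exists>xs. distinct xs \<and> set xs = S \<and> d = enc_list (map enc_nat xs))"

record 'i min_problem =
  instances :: "'i set"
  encodes :: "'i \<Rightarrow> data \<Rightarrow> bool"
  feasible :: "'i \<Rightarrow> nat set \<Rightarrow> bool"
  objective :: "'i \<Rightarrow> nat set \<Rightarrow> real"

definition optimal :: "'i min_problem \<Rightarrow> 'i \<Rightarrow> nat set \<Rightarrow> bool" where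
  "optimal P i H \<longleftrightarrow>
     feasible P i H \<and> (\<forall>H'. feasible P i H' \<longrightarrow> objective P i H \<le> objective P i H')"

text \<open>
  A correct answer is an optimal solution, or the report \<^term>\<open>Num 0\<close> (which encodes no set)
  if there is none.
\<close>

definition correct_answer :: "'i min_problem \<Rightarrow> 'i \<Rightarrow> data \<Rightarrow> bool" where
  "correct_answer P i y \<longleftrightarrow>
     (if \<exists>H. optimal P i H then \<exists>H. optimal P i H \<and> encodes_set H y else y = Num 0)"

definition solves :: "(data \<Rightarrow> data) \<Rightarrow> 'i min_problem \<Rightarrow> bool" where
  "solves f P \<longleftrightarrow> (\<forall>i \<in> instances P. \<forall>d. encodes P i d \<longrightarrow> correct_answer P i (f d))"

text \<open>Polynomial-time Turing (Cook) reducibility of search problems.\<close>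

definition poly_time_reducible :: "'i min_problem \<Rightarrow> 'j min_problem \<Rightarrow> bool" where
  "poly_time_reducible P Q \<longleftrightarrow>
     (\<exists>(c :: com) (p :: nat poly). \<forall>f. solves f Q \<longrightarrow>
        (\<forall>i \<in> instances P. \<forall>d. encodes P i d \<longrightarrow>
           (\<exists>y. computes_within f c d (poly p (data_size d)) y \<and> correct_answer P i y)))"

definition poly_time_equivalent :: "'i min_problem \<Rightarrow> 'j min_problem \<Rightarrow> bool" where
  "poly_time_equivalent P Q \<longleftrightarrow> poly_time_reducible P Q \<and> poly_time_reducible Q P"

section \<open>The two blocking problems\<close>

text \<open>
  Nodes and arcs are named by natural numbers. A digraph with costs and weights is
  given by the list of its nodes and the list of its arcs, each arc as
  (name, tail, head, cost, weight); the order within the lists is arbitrary.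
\<close>

definition enc_arc ::
  "(nat, nat) pre_digraph \<Rightarrow> (nat \<Rightarrow> real) \<Rightarrow> (nat \<Rightarrow> real) \<Rightarrow> nat \<Rightarrow> data" where
  "enc_arc G c w a =
     enc_list [enc_nat a, enc_nat (tail G a), enc_nat (head G a), Num (c a), Num (w a)]"

definition encodes_arcs ::
  "(nat, nat) pre_digraph \<Rightarrow> (nat \<Rightarrow> real) \<Rightarrow> (nat \<Rightarrow> real) \<Rightarrow> data \<Rightarrow> bool" where
  "encodes_arcs G c w d \<longleftrightarrow>
     (\<exists>as. distinct as \<and> set as = arcs G \<and> d = enc_list (map (enc_arc G c w) as))"

type_synonym inst = "(nat, nat) pre_digraph \<times> nat \<times> (nat \<Rightarrow> real) \<times> (nat \<Rightarrow> real)"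

type_synonym rooted_inst =
  "(nat, nat) pre_digraph \<times> nat \<times> nat \<times> (nat \<Rightarrow> real) \<times> (nat \<Rightarrow> real)"

definition blocking_union_arborescences :: "inst min_problem" where
  "blocking_union_arborescences = \<lparr>
     instances = {(G, k, c, w). fin_digraph G \<and> k > 0 \<and> (\<forall>a \<in> arcs G. w a \<ge> 0)},
     encodes = (\<lambda>(G, k, c, w) d. \<exists>dV dA. encodes_set (verts G) dV \<and> encodes_arcs G c w dA \<and>
                  d = enc_list [dV, dA, enc_nat k]),
     feasible = (\<lambda>(G, k, c, w). blocks_optimal G c (union_arborescence G k)),
     objective = (\<lambda>(G, k, c, w). sum w)\<rparr>"

definition blocking_union_r_arborescences :: "rooted_inst min_problem" where
  "blocking_union_r_arborescences = \<lparr>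
     instances = {(G, r, k, c, w). fin_digraph G \<and> r \<in> verts G \<and> k > 0 \<and>
                  (\<forall>a \<in> arcs G. w a \<ge> 0)},
     encodes = (\<lambda>(G, r, k, c, w) d. \<exists>dV dA. encodes_set (verts G) dV \<and> encodes_arcs G c w dA \<and>
                  d = enc_list [dV, dA, enc_nat r, enc_nat k]),
     feasible = (\<lambda>(G, r, k, c, w). blocks_optimal G c (union_r_arborescence G r k)),
     objective = (\<lambda>(G, r, k, c, w). sum w)\<rparr>"

end

theory Submission
  imports Defs
begin

text \<open>
  From (2) to (1): once the arcs entering \<open>r\<close> are deleted, every spanning arborescence is rooted
  at \<open>r\<close>, and spanning \<open>r\<close>-arborescences never use the deleted arcs.

  From (1) to (2): add a root \<open>r\<close> with \<open>k\<close> arcs of huge cost and huge weight to every node, so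
  that optimal solutions use exactly \<open>k\<close> of them, one in each arborescence, and minimum blockers
  avoid them. If \<open>D\<^sub>1\<close> has no \<open>k\<close>-union-arborescence, such solutions need not exist; therefore
  also add \<open>k\<close> arcs of large (but much smaller) cost and weight zero from one fixed node to every
  node. These penalty arcs occur in no optimal solution if \<open>D\<^sub>1\<close> has a \<open>k\<close>-union-arborescence, and
  in every optimal solution otherwise; in the latter case a minimum blocker has weight zero. Either
  way the original arcs of a minimum blocker form a minimum blocker for \<open>D\<^sub>1\<close>. As the number \<open>k\<close>
  is a single cell of the input, the \<open>k\<close> copies are affordable only because an instance with
  at least two nodes and fewer than \<open>k\<close> arcs has no \<open>k\<close>-union-arborescence at all.
\<close>

section \<open>Arborescences\<close>

text \<open>Parallel arcs are identified here, which is harmless as only acyclicity and predecessors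
  are read off this relation.\<close>

definition ends :: "('a, 'b) pre_digraph \<Rightarrow> 'b set \<Rightarrow> ('a \<times> 'a) set" where
  "ends G B = (\<lambda>a. (tail G a, head G a)) ` B"

text \<open>A nonempty closed walk contains a cycle. Freeness of cycles thus becomes acyclicity of a
  relation, for which \<open>acyclic_insert\<close>, \<open>acyclic_subset\<close> and
  \<open>finite_acyclic_wf\<close> are at hand.\<close>

lemma ex_cycle_iff_not_acyclic:
  assumes "wf_digraph G"
  shows "(\<exists>p. pre_digraph.cycle G p) \<longleftrightarrow> \<not> acyclic (arcs_ends G)"
proof -
  interpret wf_digraph G by fact
  show ?thesis
  proof
    assume "\<exists>p. cycle p"
    then obtain p u where "awalk u p u" "p \<noteq> []" unfolding cycle_def by blast
    then have "u \<rightarrow>\<^sup>+\<^bsub>G\<^esub> u" by (rule reachable1_awalkI)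
    then show "\<not> acyclic (arcs_ends G)" by (auto simp: acyclic_def)
  next
    assume "\<not> acyclic (arcs_ends G)"
    then obtain u where "u \<rightarrow>\<^sup>+\<^bsub>G\<^esub> u" by (auto simp: acyclic_def)
    then obtain p where "awalk u p u" "p \<noteq> []" by (auto simp: reachable1_awalk)
    then have "closed_w p" by (auto simp: closed_w_def)
    then show "\<exists>p. cycle p" by (rule closed_w_imp_cycle)
  qed
qed

text \<open>Working form of the definition: in-degrees become statements about entering arcs.
  Finiteness of \<open>B\<close> matters at the root, since \<open>card\<close> is also 0 on
  infinite sets.\<close>

lemma spanning_arborescence_iff:
  assumes "fin_digraph G"
  shows "spanning_arborescence G r B \<longleftrightarrow>
    r \<in> verts G \<and> B \<subseteq> arcs G \<and> acyclic (ends G B) \<and> (\<forall>a\<in>B. head G a \<noteq> r) \<and>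
    (\<forall>v \<in> verts G - {r}. \<exists>!a. a \<in> B \<and> head G a = v)"
proof (cases "B \<subseteq> arcs G")
  case True
  interpret fin_digraph G by fact
  have finB: "finite B" using True finite_arcs finite_subset by blast
  have wf: "wf_digraph (G\<lparr>arcs := B\<rparr>)"
    using True by (auto simp: wf_digraph_def wellformed)
  have ends: "arcs_ends (G\<lparr>arcs := B\<rparr>) = ends G B"
    by (simp add: arcs_ends_conv ends_def)
  have "in_degree (G\<lparr>arcs := B\<rparr>) r = 0 \<longleftrightarrow> (\<forall>a\<in>B. head G a \<noteq> r)"
    using finB by (auto simp: in_degree_def in_arcs_def)
  moreover have "in_degree (G\<lparr>arcs := B\<rparr>) v = 1 \<longleftrightarrow> (\<exists>!a. a \<in> B \<and> head G a = v)" for v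
    unfolding in_degree_def in_arcs_def One_nat_def card_1_singleton_iff
    by (simp add: set_eq_iff) metis
  ultimately show ?thesis
    using True ex_cycle_iff_not_acyclic[OF wf]
    unfolding spanning_arborescence_def ends by auto
qed (auto simp: spanning_arborescence_def)

text \<open>A non-root node that is minimal in the well-founded arc relation has an entering arc,
  whose tail must be the root.\<close>

lemma spanning_arborescence_root_arc:
  assumes G: "fin_digraph G" and B: "spanning_arborescence G r B" and v: "v \<in> verts G" "v \<noteq> r"
  shows "\<exists>a\<in>B. tail G a = r"
proof (rule ccontr)
  assume no: "\<not> ?thesis"
  interpret fin_digraph G by fact
  note B = B[unfolded spanning_arborescence_iff[OF G]]
  have "finite (ends G B)"
    using B finite_arcs finite_subset unfolding ends_def by blast
  then have "wf (ends G B)" using B by (blast intro: finite_acyclic_wf)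
  then obtain z where z: "z \<in> verts G - {r}"
    and min: "\<And>y. (y, z) \<in> ends G B \<Longrightarrow> y \<notin> verts G - {r}"
    using v by (elim wfE_min[of _ v "verts G - {r}"]) auto
  obtain a where a: "a \<in> B" "head G a = z" using B z by blast
  then have "(tail G a, z) \<in> ends G B" by (auto simp: ends_def)
  moreover have "tail G a \<in> verts G - {r}" using a no B by (auto intro: tail_in_verts)
  ultimately show False using min by blast
qed

section \<open>Unions of arborescences\<close>

lemma union_r_arborescence_subset:
  assumes "union_r_arborescence G r k B"
  shows "B \<subseteq> arcs G"
  using assms unfolding union_r_arborescence_def spanning_arborescence_def by blast

lemma union_arborescence_subset:
  assumes "union_arborescence G k B"
  shows "B \<subseteq> arcs G"
  using assms unfolding union_arborescence_def spanning_arborescence_def by blast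

text \<open>With one node the empty set is a spanning arborescence, and \<open>k\<close> copies of
  it are disjoint.\<close>

lemma union_arborescence_trivial:
  assumes G: "fin_digraph G" and v: "verts G = {v}"
  shows "union_arborescence G k {}"
proof -
  have "spanning_arborescence G v {}"
    using v by (auto simp: spanning_arborescence_iff[OF G] ends_def acyclic_def)
  then have "\<forall>i<k. \<exists>r. spanning_arborescence G r {}" by blast
  then show ?thesis
    unfolding union_arborescence_def disjoint_family_on_def
    by (intro exI[of _ "\<lambda>_. {}"]) auto
qed

lemma spanning_arborescence_nonempty:
  assumes G: "fin_digraph G" and B: "spanning_arborescence G r B"
    and uv: "u \<in> verts G" "v \<in> verts G" "u \<noteq> v"
  shows "B \<noteq> {}"
proof -
  obtain x where "x \<in> verts G" "x \<noteq> r" using uv by blast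
  then show ?thesis using B unfolding spanning_arborescence_iff[OF G] by blast
qed

text \<open>With two nodes each of the \<open>k\<close> disjoint arborescences is nonempty. This
  settles instances with fewer than \<open>k\<close> arcs, and shows for \<open>k > 0\<close> that
  the set of all arcs blocks.\<close>

lemma union_arborescence_card:
  assumes G: "fin_digraph G" and B: "union_arborescence G k B"
    and uv: "u \<in> verts G" "v \<in> verts G" "u \<noteq> v"
  shows "k \<le> card B"
proof -
  obtain F where F: "\<And>i. i < k \<Longrightarrow> \<exists>r. spanning_arborescence G r (F i)"
    and disj: "disjoint_family_on F {..<k}" and B': "B = (\<Union>i<k. F i)"
    using B unfolding union_arborescence_def by blast
  have fin: "finite (F i)" if "i < k" for i
    using F[OF that] fin_digraph.finite_arcs[OF G] finite_subset
    unfolding spanning_arborescence_def by blast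
  have "k = (\<Sum>i<k. 1)" by simp
  also have "\<dots> \<le> (\<Sum>i<k. card (F i))"
  proof (rule sum_mono)
    fix i assume "i \<in> {..<k}"
    then show "1 \<le> card (F i)"
      using F[of i] fin[of i] spanning_arborescence_nonempty[OF G _ uv]
      by (auto simp: Suc_le_eq card_gt_0_iff)
  qed
  also have "\<dots> = card B"
    unfolding B' using fin disj by (subst card_UN_disjoint') (auto simp: disjoint_family_on_def)
  finally show ?thesis .
qed

text \<open>
  \<open>G2\<close> is \<open>G\<close> with a new root \<open>r\<close>, \<open>k\<close> root arcs \<open>R\<close> from \<open>r\<close> to every node, and \<open>k\<close> penalty
  arcs \<open>P\<close> from \<open>v0\<close> to every node. The costs \<open>M\<close> and \<open>L\<close> make optimal solutions of \<open>G2\<close> minimize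
  lexicographically the number of root arcs, the number of penalty arcs and the original cost.
\<close>

locale root_extension =
  fixes G G2 :: "('a, 'b) pre_digraph" and r v0 :: 'a and k :: nat
    and pen root :: "'a \<Rightarrow> nat \<Rightarrow> 'b" and c c2 w w2 :: "'b \<Rightarrow> real" and L M :: real
    and P R :: "'b set"
  assumes P_def: "P = (\<lambda>(v, i). pen v i) ` (verts G \<times> {..<k})"
    and R_def: "R = (\<lambda>(v, i). root v i) ` (verts G \<times> {..<k})"
    and G: "fin_digraph G" and G2: "fin_digraph G2"
    and v0: "v0 \<in> verts G" and r: "r \<notin> verts G" and k: "k > 0"
    and two: "\<exists>v\<in>verts G. v \<noteq> v0"
    and verts2: "verts G2 = insert r (verts G)"
    and arcs2: "arcs G2 = arcs G \<union> P \<union> R"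
    and disj: "arcs G \<inter> P = {}" "arcs G \<inter> R = {}" "P \<inter> R = {}"
    and pen_inj: "\<And>u i v j. pen u i = pen v j \<Longrightarrow> u \<in> verts G \<Longrightarrow> v \<in> verts G \<Longrightarrow>
      i < k \<Longrightarrow> j < k \<Longrightarrow> i = j"
    and root_inj: "\<And>u i v j. root u i = root v j \<Longrightarrow> u \<in> verts G \<Longrightarrow> v \<in> verts G \<Longrightarrow>
      i < k \<Longrightarrow> j < k \<Longrightarrow> i = j"
    and tail_old: "\<And>a. a \<in> arcs G \<Longrightarrow> tail G2 a = tail G a"
    and head_old: "\<And>a. a \<in> arcs G \<Longrightarrow> head G2 a = head G a"
    and tail_pen: "\<And>v i. v \<in> verts G \<Longrightarrow> i < k \<Longrightarrow> tail G2 (pen v i) = v0"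
    and head_pen: "\<And>v i. v \<in> verts G \<Longrightarrow> i < k \<Longrightarrow> head G2 (pen v i) = v"
    and tail_root: "\<And>v i. v \<in> verts G \<Longrightarrow> i < k \<Longrightarrow> tail G2 (root v i) = r"
    and head_root: "\<And>v i. v \<in> verts G \<Longrightarrow> i < k \<Longrightarrow> head G2 (root v i) = v"
    and c_old: "\<And>a. a \<in> arcs G \<Longrightarrow> c2 a = c a"
    and c_pen: "\<And>a. a \<in> P \<Longrightarrow> c2 a = L"
    and c_root: "\<And>a. a \<in> R \<Longrightarrow> c2 a = M"
    and L: "L > 2 * (\<Sum>a\<in>arcs G. \<bar>c a\<bar>)"
    and M: "M > L * card P + (\<Sum>a\<in>arcs G. \<bar>c a\<bar>)"
    and w_old: "\<And>a. a \<in> arcs G \<Longrightarrow> w2 a = w a"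
    and w_nonneg: "\<And>a. a \<in> arcs G \<Longrightarrow> w a \<ge> 0"
    and w_pen: "\<And>a. a \<in> P \<Longrightarrow> w2 a = 0"
    and w_root: "\<And>a. a \<in> R \<Longrightarrow> w2 a > (\<Sum>a\<in>arcs G. w a)"
begin

section \<open>Arcs of the extended digraph\<close>

lemma finite_arcs_G [simp]: "finite (arcs G)" and finite_verts_G [simp]: "finite (verts G)"
  using G by (auto simp: fin_digraph.finite_arcs fin_digraph.finite_verts)

lemma finite_P [simp]: "finite P" and finite_R [simp]: "finite R"
  by (auto simp: P_def R_def)

lemma head2_in_verts: "a \<in> arcs G2 \<Longrightarrow> head G2 a \<in> verts G"
  using fin_digraph.axioms(1)[OF G]
  by (auto simp: arcs2 P_def R_def head_old head_pen head_root wf_digraph.head_in_verts)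

lemma tail2_eq_r_iff: "a \<in> arcs G2 \<Longrightarrow> tail G2 a = r \<longleftrightarrow> a \<in> R"
proof -
  assume "a \<in> arcs G2"
  moreover have "a \<in> arcs G \<Longrightarrow> tail G2 a \<noteq> r"
    using fin_digraph.axioms(1)[OF G] r by (auto simp: tail_old dest: wf_digraph.tail_in_verts)
  moreover have "a \<in> P \<Longrightarrow> tail G2 a \<noteq> r" using v0 r by (auto simp: P_def tail_pen)
  moreover have "a \<in> R \<Longrightarrow> tail G2 a = r" by (auto simp: R_def tail_root)
  ultimately show ?thesis unfolding arcs2 using disj by blast
qed

text \<open>The extension without its root: \<open>G\<close> together with the penalty arcs. An
  \<open>r\<close>-arborescence of \<open>G2\<close> with a single root arc is an arborescence of
  \<open>core\<close> plus that arc.\<close>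

definition core :: "('a, 'b) pre_digraph" where
  "core = G2\<lparr>verts := verts G, arcs := arcs G \<union> P\<rparr>"

lemma fin_core: "fin_digraph core"
proof
  fix e assume e: "e \<in> arcs core"
  then have e2: "e \<in> arcs G2" "e \<notin> R" using disj by (auto simp: core_def arcs2)
  then have "tail G2 e \<in> verts G2"
    using fin_digraph.axioms(1)[OF G2] by (simp add: wf_digraph.tail_in_verts)
  then show "tail core e \<in> verts core"
    using e2 tail2_eq_r_iff[of e] by (auto simp: core_def verts2)
  show "head core e \<in> verts core" using e2 head2_in_verts by (simp add: core_def)
qed (auto simp: core_def)

lemma core_ends: "ends core B = ends G2 B"
  by (simp add: ends_def core_def)

text \<open>An arborescence of \<open>core\<close> free of penalty arcs is one of \<open>G\<close>,
  because tails and heads of \<open>G2\<close> and \<open>G\<close> agree on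
  \<open>arcs G\<close>.\<close>

lemma spanning_arborescence_core_iff:
  "spanning_arborescence G v B \<longleftrightarrow> spanning_arborescence core v B \<and> B \<subseteq> arcs G"
proof (cases "B \<subseteq> arcs G")
  case True
  then have "ends core B = ends G B"
    unfolding ends_def by (intro image_cong) (auto simp: core_def tail_old head_old)
  moreover have "\<And>a. a \<in> B \<Longrightarrow> head core a = head G a"
    using True head_old by (auto simp: core_def)
  ultimately show ?thesis
    using True unfolding spanning_arborescence_iff[OF G] spanning_arborescence_iff[OF fin_core]
    by (auto simp: core_def cong: conj_cong)
qed (auto simp: spanning_arborescence_def)

section \<open>Attaching and removing root arcs\<close>

lemma add_root_arc:
  assumes B: "spanning_arborescence core v B" and i: "i < k"
  shows "spanning_arborescence G2 r (insert (root v i) B)"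
proof -
  note B = B[unfolded spanning_arborescence_iff[OF fin_core] core_ends]
  have v: "v \<in> verts G" using B by (simp add: core_def)
  have BG: "B \<subseteq> arcs G \<union> P" using B by (simp add: core_def)
  have sub: "insert (root v i) B \<subseteq> arcs G2" using BG i v by (auto simp: arcs2 R_def)
  \<comment> \<open>No arc enters \<open>r\<close>, so \<open>v\<close> cannot reach
    \<open>r\<close> and the new arc from \<open>r\<close> to \<open>v\<close> closes no
    cycle.\<close>
  have "(v, r) \<notin> (ends G2 B)\<^sup>*"
  proof
    assume "(v, r) \<in> (ends G2 B)\<^sup>*"
    then show False
      by (cases rule: rtranclE) (use v r sub head2_in_verts in \<open>auto simp: ends_def\<close>)
  qed
  then have "acyclic (ends G2 (insert (root v i) B))"
    using B v i by (simp add: ends_def acyclic_insert tail_root head_root)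
  moreover have "\<exists>!a. a \<in> insert (root v i) B \<and> head G2 a = u" if u: "u \<in> verts G2 - {r}" for u
  proof (cases "u = v")
    case True
    then show ?thesis using B v i by (auto simp: core_def head_root)
  next
    case False
    then have "u \<in> verts G - {v}" using u by (auto simp: verts2)
    then have "\<exists>!a. a \<in> B \<and> head G2 a = u" using B by (simp add: core_def)
    then show ?thesis using False v i by (auto simp: head_root)
  qed
  ultimately show ?thesis
    using sub head2_in_verts r by (auto simp: spanning_arborescence_iff[OF G2] verts2)
qed

text \<open>Removing the only root arc \<open>a\<close> leaves its head without entering arcs, so
  that head becomes the new root.\<close>

lemma remove_root_arc:
  assumes B: "spanning_arborescence G2 r B" and a: "B \<inter> R = {a}"
  shows "spanning_arborescence core (head G2 a) (B - {a})"
proof -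
  note B = B[unfolded spanning_arborescence_iff[OF G2]]
  have aB: "a \<in> B" and aR: "a \<in> R" using a by auto
  have "head G2 a \<in> verts G" using B aB head2_in_verts by blast
  moreover have "B - {a} \<subseteq> arcs G \<union> P" using B a by (auto simp: arcs2)
  moreover have "acyclic (ends G2 (B - {a}))"
    using B by (auto simp: ends_def intro: acyclic_subset)
  moreover have "head G2 b \<noteq> head G2 a" if "b \<in> B - {a}" for b
    using B that aB \<open>head G2 a \<in> verts G\<close> r by (auto simp: verts2)
  moreover have "\<exists>!b. b \<in> B - {a} \<and> head G2 b = u" if u: "u \<in> verts G - {head G2 a}" for u
  proof -
    have "\<exists>!b. b \<in> B \<and> head G2 b = u" using B u r by (auto simp: verts2)
    then show ?thesis using u by auto
  qed
  ultimately show ?thesis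
    by (simp add: spanning_arborescence_iff[OF fin_core] core_ends) (auto simp: core_def)
qed

section \<open>Counting root arcs\<close>

lemma root_arc_count:
  assumes F: "\<And>i. i < k \<Longrightarrow> spanning_arborescence G2 r (F i)"
    and disj: "disjoint_family_on F {..<k}"
  shows "card ((\<Union>i<k. F i) \<inter> R) = (\<Sum>i<k. card (F i \<inter> R))"
    and "\<And>i. i < k \<Longrightarrow> 1 \<le> card (F i \<inter> R)"
proof -
  have "(\<Union>i<k. F i) \<inter> R = (\<Union>i<k. F i \<inter> R)" by blast
  then show "card ((\<Union>i<k. F i) \<inter> R) = (\<Sum>i<k. card (F i \<inter> R))"
    using card_UN_disjoint'[of "\<lambda>i. F i \<inter> R" "{..<k}"] disj
    by (auto simp: disjoint_family_on_def)
  fix i assume i: "i < k"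
  obtain a where "a \<in> F i" "tail G2 a = r"
    using spanning_arborescence_root_arc[OF G2 F[OF i], of v0] v0 r by (auto simp: verts2)
  moreover have "F i \<subseteq> arcs G2" using F[OF i] by (simp add: spanning_arborescence_def)
  ultimately have "F i \<inter> R \<noteq> {}" using tail2_eq_r_iff by blast
  then show "1 \<le> card (F i \<inter> R)" by (simp add: Suc_le_eq card_gt_0_iff)
qed

lemma root_arc_count_ge:
  assumes "union_r_arborescence G2 r k B"
  shows "k \<le> card (B \<inter> R)"
proof -
  obtain F where F: "\<And>i. i < k \<Longrightarrow> spanning_arborescence G2 r (F i)"
    and dj: "disjoint_family_on F {..<k}" and B: "B = (\<Union>i<k. F i)"
    using assms unfolding union_r_arborescence_def by blast
  have "(\<Sum>i<k. 1) \<le> (\<Sum>i<k. card (F i \<inter> R))"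
    by (rule sum_mono) (use root_arc_count(2)[OF F dj] in auto)
  then show ?thesis using root_arc_count(1)[OF F dj] B by simp
qed

lemma union_r_arborescence_remove_root_arcs:
  assumes "union_r_arborescence G2 r k B" and card: "card (B \<inter> R) = k" and P: "B \<inter> P = {}"
  shows "union_arborescence G k (B \<inter> arcs G)"
proof -
  obtain F where F: "\<And>i. i < k \<Longrightarrow> spanning_arborescence G2 r (F i)"
    and dj: "disjoint_family_on F {..<k}" and B: "B = (\<Union>i<k. F i)"
    using assms unfolding union_r_arborescence_def by blast
  \<comment> \<open>Every part has at least one root arc, so a part with two of them would push the
    total above \<open>k\<close>.\<close>
  have one: "card (F i \<inter> R) = 1" if i: "i < k" for i
  proof (rule ccontr)
    assume "card (F i \<inter> R) \<noteq> 1"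
    then have "1 < card (F i \<inter> R)" using root_arc_count(2)[OF F dj i] by simp
    then have "(\<Sum>j<k. 1) < (\<Sum>j<k. card (F j \<inter> R))"
      using i root_arc_count(2)[OF F dj] by (intro sum_strict_mono_ex1) auto
    then show False using card B root_arc_count(1)[OF F dj] by simp
  qed
  have "\<exists>v. spanning_arborescence G v (F i \<inter> arcs G)" if i: "i < k" for i
  proof -
    obtain a where a: "F i \<inter> R = {a}" using one[OF i] card_1_singletonE by blast
    have "F i \<subseteq> arcs G2" using F[OF i] by (simp add: spanning_arborescence_def)
    then have "F i \<inter> arcs G = F i - {a}" using P B i a disj by (auto simp: arcs2)
    then show ?thesis
      using remove_root_arc[OF F[OF i] a] by (auto simp: spanning_arborescence_core_iff)
  qed
  moreover have "disjoint_family_on (\<lambda>i. F i \<inter> arcs G) {..<k}"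
    using dj by (auto simp: disjoint_family_on_def)
  moreover have "B \<inter> arcs G = (\<Union>i<k. F i \<inter> arcs G)" using B by blast
  ultimately show ?thesis unfolding union_arborescence_def
    by (intro exI[of _ "\<lambda>i. F i \<inter> arcs G"]) auto
qed

text \<open>The \<open>i\<close>-th arborescence receives the \<open>i\<close>-th copy of the arc
  from \<open>r\<close> to its root. Arborescences with the same root thus stay disjoint, which is
  why there are \<open>k\<close> copies per node.\<close>

lemma union_arborescence_core_add_root_arcs:
  assumes "union_arborescence core k B"
  obtains B2 where "union_r_arborescence G2 r k B2" "card (B2 \<inter> R) = k" "B2 - R = B"
proof -
  obtain F where F: "\<forall>i<k. \<exists>v. spanning_arborescence core v (F i)"
    and dj: "disjoint_family_on F {..<k}" and B: "B = (\<Union>i<k. F i)"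
    using assms unfolding union_arborescence_def by blast
  obtain s where s: "\<And>i. i < k \<Longrightarrow> spanning_arborescence core (s i) (F i)"
    using F by metis
  have sv: "s i \<in> verts G" and FG: "F i \<subseteq> arcs G \<union> P" if "i < k" for i
    using s[OF that] by (auto simp: spanning_arborescence_def core_def)
  define F2 where "F2 i = insert (root (s i) i) (F i)" for i
  have rR: "root (s i) i \<in> R" if "i < k" for i using sv that by (auto simp: R_def)
  have FR: "F i \<inter> R = {}" if "i < k" for i using FG[OF that] disj by blast
  have inj: "inj_on (\<lambda>i. root (s i) i) {..<k}"
    using sv by (auto simp: inj_on_def dest: root_inj)
  have "disjoint_family_on F2 {..<k}"
    unfolding disjoint_family_on_def
  proof (intro ballI impI)
    fix i j assume ij: "i \<in> {..<k}" "j \<in> {..<k}" "i \<noteq> j"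
    then have "F i \<inter> F j = {}" using dj by (auto simp: disjoint_family_on_def)
    moreover have "root (s i) i \<noteq> root (s j) j" using ij inj by (auto simp: inj_on_def)
    ultimately show "F2 i \<inter> F2 j = {}"
      using ij FR[of i] FR[of j] rR[of i] rR[of j] by (auto simp: F2_def)
  qed
  moreover have "\<forall>i<k. spanning_arborescence G2 r (F2 i)"
    using s add_root_arc by (simp add: F2_def)
  ultimately have "union_r_arborescence G2 r k (\<Union>i<k. F2 i)"
    unfolding union_r_arborescence_def by blast
  moreover have "(\<Union>i<k. F2 i) \<inter> R = (\<lambda>i. root (s i) i) ` {..<k}"
    using FR rR by (auto simp: F2_def)
  then have "card ((\<Union>i<k. F2 i) \<inter> R) = k" using inj by (simp add: card_image)
  moreover have "(\<Union>i<k. F2 i) - R = B" using FR rR B by (auto simp: F2_def)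
  ultimately show thesis using that by blast
qed

lemma union_arborescence_core:
  assumes "union_arborescence G k B"
  shows "union_arborescence core k B"
  using assms unfolding union_arborescence_def spanning_arborescence_core_iff by blast

text \<open>The \<open>k\<close> copies of the star centred at \<open>v0\<close> give
  \<open>core\<close> a \<open>k\<close>-union-arborescence even if \<open>G\<close> has
  none.\<close>

lemma star_union_arborescence:
  obtains B where "B \<subseteq> P" "union_arborescence core k B"
proof -
  define F where "F i = (\<lambda>v. pen v i) ` (verts G - {v0})" for i
  have sub: "F i \<subseteq> P" if "i < k" for i using that by (auto simp: F_def P_def)
  have "spanning_arborescence core v0 (F i)" if i: "i < k" for i
  proof -
    \<comment> \<open>All arcs leave \<open>v0\<close> and none enters it, so no two of them can be
      composed.\<close>
    have "ends G2 (F i) \<subseteq> {v0} \<times> (- {v0})"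
      using i by (auto simp: F_def ends_def tail_pen head_pen)
    then have "acyclic (ends G2 (F i))"
      by (rule acyclic_subset[rotated]) (auto simp: acyclic_def trancl_def elim: tranclp.cases elim!: converse_tranclpE)
    then show ?thesis
      using sub[OF i] i v0
      by (simp add: spanning_arborescence_iff[OF fin_core] core_ends)
        (auto simp: core_def F_def head_pen)
  qed
  moreover have "disjoint_family_on F {..<k}"
    unfolding disjoint_family_on_def F_def using pen_inj by fastforce
  ultimately have "union_arborescence core k (\<Union>i<k. F i)"
    unfolding union_arborescence_def by blast
  moreover have "(\<Union>i<k. F i) \<subseteq> P" using sub by blast
  ultimately show thesis using that by blast
qed

section \<open>Costs of solutions in the extension\<close>

lemma cost_split:
  assumes "B \<subseteq> arcs G2"
  shows "sum c2 B = sum c (B \<inter> arcs G) + L * card (B \<inter> P) + M * card (B \<inter> R)"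
proof -
  have "B = (B \<inter> arcs G) \<union> (B \<inter> P) \<union> (B \<inter> R)" using assms by (auto simp: arcs2)
  then have "sum c2 B = sum c2 ((B \<inter> arcs G) \<union> (B \<inter> P) \<union> (B \<inter> R))" by simp
  also have "\<dots> = sum c2 (B \<inter> arcs G) + sum c2 (B \<inter> P) + sum c2 (B \<inter> R)"
    using disj by (subst sum.union_disjoint; (subst sum.union_disjoint)?; auto)
  also have "sum c2 (B \<inter> arcs G) = sum c (B \<inter> arcs G)" by (rule sum.cong) (auto simp: c_old)
  also have "sum c2 (B \<inter> P) = (\<Sum>a\<in>B \<inter> P. L)" by (rule sum.cong) (auto simp: c_pen)
  also have "sum c2 (B \<inter> R) = (\<Sum>a\<in>B \<inter> R. M)" by (rule sum.cong) (auto simp: c_root)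
  finally show ?thesis by (simp add: mult.commute)
qed

lemma abs_cost_le:
  assumes "B \<subseteq> arcs G"
  shows "\<bar>sum c B\<bar> \<le> (\<Sum>a\<in>arcs G. \<bar>c a\<bar>)"
proof -
  have "\<bar>sum c B\<bar> \<le> (\<Sum>a\<in>B. \<bar>c a\<bar>)" by (rule sum_abs)
  also have "\<dots> \<le> (\<Sum>a\<in>arcs G. \<bar>c a\<bar>)" using assms by (intro sum_mono2) auto
  finally show ?thesis .
qed

lemma L_pos: "L > 0"
  using L sum_nonneg[of "arcs G" "\<lambda>a. \<bar>c a\<bar>"] by linarith

lemma M_pos: "M > 0"
proof -
  have "0 \<le> L * card P" using L_pos by simp
  then show ?thesis using M sum_nonneg[of "arcs G" "\<lambda>a. \<bar>c a\<bar>"] by linarith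
qed

text \<open>More than \<open>k\<close> root arcs cost at least \<open>M * (k + 1)\<close> minus the
  total absolute cost of \<open>G\<close>, whereas the star solution costs at most
  \<open>M * k + L * card P\<close>; the choice of \<open>M\<close> makes the latter
  smaller.\<close>

lemma min_cost_root_arcs:
  assumes "min_cost c2 (union_r_arborescence G2 r k) B"
  shows "card (B \<inter> R) = k"
proof (rule ccontr)
  assume ne: "card (B \<inter> R) \<noteq> k"
  have B: "union_r_arborescence G2 r k B"
    and min: "\<And>B'. union_r_arborescence G2 r k B' \<Longrightarrow> sum c2 B \<le> sum c2 B'"
    using assms by (auto simp: min_cost_def)
  have "k + 1 \<le> card (B \<inter> R)" using ne root_arc_count_ge[OF B] by simp
  then have "M * (real k + 1) \<le> M * card (B \<inter> R)"
    using M_pos by (intro mult_left_mono) (auto simp flip: of_nat_Suc)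
  moreover have "0 \<le> L * card (B \<inter> P)" using L_pos by simp
  moreover have "- (\<Sum>a\<in>arcs G. \<bar>c a\<bar>) \<le> sum c (B \<inter> arcs G)"
    using abs_cost_le[of "B \<inter> arcs G"] by auto
  ultimately have low: "M * (real k + 1) - (\<Sum>a\<in>arcs G. \<bar>c a\<bar>) \<le> sum c2 B"
    using cost_split[OF union_r_arborescence_subset[OF B]] by simp
  obtain S where S: "S \<subseteq> P" "union_arborescence core k S" by (rule star_union_arborescence)
  obtain B' where B': "union_r_arborescence G2 r k B'" "card (B' \<inter> R) = k" "B' - R = S"
    using union_arborescence_core_add_root_arcs[OF S(2)] by blast
  have "B' \<inter> arcs G = {}" using B'(3) S(1) disj by blast
  moreover have "L * card (B' \<inter> P) \<le> L * card P"
    using L_pos by (intro mult_left_mono) (auto intro: card_mono)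
  ultimately have "sum c2 B' \<le> L * card P + M * k"
    using cost_split[OF union_r_arborescence_subset[OF B'(1)]] B'(2) by simp
  then show False using low min[OF B'(1)] M by (simp add: algebra_simps)
qed

lemma add_root_arcs_cost:
  assumes B1: "union_arborescence G k B1"
  obtains B where "union_r_arborescence G2 r k B" "B - R = B1" "B \<inter> arcs G = B1"
    "sum c2 B = M * k + sum c B1"
proof -
  obtain B where B: "union_r_arborescence G2 r k B" "card (B \<inter> R) = k" "B - R = B1"
    using union_arborescence_core_add_root_arcs[OF union_arborescence_core[OF B1]] by blast
  have B1A: "B1 \<subseteq> arcs G" using union_arborescence_subset[OF B1] .
  then have "B \<inter> arcs G = B1" "B \<inter> P = {}" using B(3) disj by blast+
  then show thesis
    using that B cost_split[OF union_r_arborescence_subset[OF B(1)]] by simp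
qed

text \<open>Once the number of root arcs is fixed at \<open>k\<close>, a penalty arc costs
  \<open>L\<close>, which is more than the costs of two subsets of \<open>arcs G\<close> can
  differ.\<close>

lemma min_cost_no_penalty:
  assumes B: "min_cost c2 (union_r_arborescence G2 r k) B" and B1: "union_arborescence G k B1"
  shows "B \<inter> P = {}"
proof (rule ccontr)
  assume ne: "B \<inter> P \<noteq> {}"
  obtain B' where B': "union_r_arborescence G2 r k B'" "sum c2 B' = M * k + sum c B1"
    using add_root_arcs_cost[OF B1] by blast
  have le: "sum c2 B \<le> sum c2 B'" and u: "union_r_arborescence G2 r k B"
    using B B'(1) by (auto simp: min_cost_def)
  have "1 \<le> card (B \<inter> P)" using ne by (simp add: Suc_le_eq card_gt_0_iff)
  then have "L * 1 \<le> L * card (B \<inter> P)" using L_pos by (intro mult_left_mono) auto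
  moreover have "- (\<Sum>a\<in>arcs G. \<bar>c a\<bar>) \<le> sum c (B \<inter> arcs G)"
    using abs_cost_le[of "B \<inter> arcs G"] by auto
  moreover have "sum c B1 \<le> (\<Sum>a\<in>arcs G. \<bar>c a\<bar>)"
    using abs_cost_le[OF union_arborescence_subset[OF B1]] by auto
  ultimately show False
    using L le B'(2) cost_split[OF union_r_arborescence_subset[OF u]]
      min_cost_root_arcs[OF B] by simp
qed

lemma ex_min_cost:
  obtains B where "min_cost c2 (union_r_arborescence G2 r k) B"
proof -
  let ?U = "{B. union_r_arborescence G2 r k B}"
  have "?U \<subseteq> Pow (arcs G2)" using union_r_arborescence_subset by (metis Pow_iff mem_Collect_eq subsetI)
  then have "finite ?U"
    using finite_subset fin_digraph.finite_arcs[OF G2] by blast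
  moreover obtain S where "union_arborescence core k S" by (rule star_union_arborescence)
  then have "?U \<noteq> {}" using union_arborescence_core_add_root_arcs by blast
  ultimately obtain B where "is_arg_min (sum c2) (\<lambda>B. B \<in> ?U) B"
    using ex_is_arg_min_if_finite by blast
  then show thesis using that by (auto simp: is_arg_min_linorder min_cost_def)
qed

text \<open>With \<open>k\<close> root arcs and no penalty arc, costs in \<open>G2\<close> are those
  in \<open>G\<close> shifted by the constant \<open>M * k\<close>, so optimality carries
  over.\<close>

lemma min_cost_restrict:
  assumes B: "min_cost c2 (union_r_arborescence G2 r k) B" and ex: "union_arborescence G k B0"
  shows "min_cost c (union_arborescence G k) (B \<inter> arcs G)"
proof -
  have u: "union_r_arborescence G2 r k B" using B by (auto simp: min_cost_def)
  have P: "B \<inter> P = {}" and R: "card (B \<inter> R) = k"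
    using min_cost_no_penalty[OF B ex] min_cost_root_arcs[OF B] .
  have "sum c (B \<inter> arcs G) \<le> sum c B1" if B1: "union_arborescence G k B1" for B1
  proof -
    obtain B' where "union_r_arborescence G2 r k B'" "sum c2 B' = M * k + sum c B1"
      using add_root_arcs_cost[OF B1] by blast
    then have "sum c2 B \<le> M * k + sum c B1" using B by (auto simp: min_cost_def)
    then show ?thesis
      using cost_split[OF union_r_arborescence_subset[OF u]] P R by simp
  qed
  then show ?thesis
    using union_r_arborescence_remove_root_arcs[OF u R P] by (simp add: min_cost_def)
qed

lemma min_cost_extend:
  assumes B1: "min_cost c (union_arborescence G k) B1"
  obtains B where "min_cost c2 (union_r_arborescence G2 r k) B" "B - R = B1"
proof -
  have u1: "union_arborescence G k B1" using B1 by (auto simp: min_cost_def)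
  obtain B where B: "union_r_arborescence G2 r k B" "B - R = B1" "sum c2 B = M * k + sum c B1"
    using add_root_arcs_cost[OF u1] by blast
  \<comment> \<open>The optimum \<open>B0\<close> of \<open>G2\<close> serves for comparison: its
    restriction to \<open>arcs G\<close> is a solution of \<open>G\<close> and so costs no less than
    \<open>B1\<close>.\<close>
  obtain B0 where B0: "min_cost c2 (union_r_arborescence G2 r k) B0" by (rule ex_min_cost)
  then have u0: "union_r_arborescence G2 r k B0" by (auto simp: min_cost_def)
  have "sum c B1 \<le> sum c (B0 \<inter> arcs G)"
    using B1 min_cost_restrict[OF B0 u1] by (auto simp: min_cost_def)
  then have "sum c2 B \<le> sum c2 B0"
    using B(3) cost_split[OF union_r_arborescence_subset[OF u0]]
      min_cost_no_penalty[OF B0 u1] min_cost_root_arcs[OF B0] by simp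
  then have "min_cost c2 (union_r_arborescence G2 r k) B"
    using B0 B(1) by (fastforce simp: min_cost_def)
  then show thesis using that B(2) by blast
qed

section \<open>Minimum blockers of the extension\<close>

lemma w2_nonneg: "a \<in> arcs G2 \<Longrightarrow> 0 \<le> w2 a"
  using w_old w_nonneg w_pen w_root sum_nonneg[of "arcs G" w]
  by (fastforce simp: arcs2)

text \<open>
  If \<open>G\<close> has no \<open>k\<close>-union-arborescence, the weightless penalty arcs block \<open>G2\<close>, so a minimum
  blocker of \<open>G2\<close> has weight zero, as does the empty blocker of \<open>G\<close>.
\<close>

lemma minimum_blocker_restrict:
  assumes H: "blocks_optimal G2 c2 (union_r_arborescence G2 r k) H"
    and min: "\<And>H'. blocks_optimal G2 c2 (union_r_arborescence G2 r k) H' \<Longrightarrow> sum w2 H \<le> sum w2 H'"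
  shows "blocks_optimal G c (union_arborescence G k) (H \<inter> arcs G)"
    and "\<And>H'. blocks_optimal G c (union_arborescence G k) H' \<Longrightarrow> sum w (H \<inter> arcs G) \<le> sum w H'"
proof -
  have HA: "H \<subseteq> arcs G2" using H by (simp add: blocks_optimal_def)
  have finH: "finite H" using HA fin_digraph.finite_arcs[OF G2] finite_subset by blast
  have "sum w (H \<inter> arcs G) = sum w2 (H \<inter> arcs G)" by (rule sum.cong) (auto simp: w_old)
  also have "\<dots> \<le> sum w2 H" using finH HA w2_nonneg by (intro sum_mono2) auto
  finally have wH: "sum w (H \<inter> arcs G) \<le> sum w2 H" .
  have feasible: "blocks_optimal G c (union_arborescence G k) (H \<inter> arcs G) \<and>
    (\<forall>H'. blocks_optimal G c (union_arborescence G k) H' \<longrightarrow> sum w (H \<inter> arcs G) \<le> sum w H')"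
    if ex: "\<exists>B0. union_arborescence G k B0"
  proof -
    obtain B0 where B0: "union_arborescence G k B0" using ex by blast
    \<comment> \<open>Optimal solutions of \<open>G2\<close> restrict to optimal solutions of
      \<open>G\<close>, so a blocker of \<open>G\<close> already blocks \<open>G2\<close>.\<close>
    have ext: "blocks_optimal G2 c2 (union_r_arborescence G2 r k) H'"
      if "blocks_optimal G c (union_arborescence G k) H'" for H'
      using that min_cost_restrict[OF _ B0] unfolding blocks_optimal_def arcs2 by blast
    have le: "sum w2 H \<le> sum w H'" if H': "blocks_optimal G c (union_arborescence G k) H'" for H'
    proof -
      have "sum w2 H' = sum w H'"
        using H' by (intro sum.cong) (auto simp: blocks_optimal_def w_old)
      then show ?thesis using min[OF ext[OF H']] by simp
    qed
    obtain v where v: "v \<in> verts G" "v0 \<noteq> v" using two by blast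
    \<comment> \<open>The set of all arcs of \<open>G\<close> is a blocker lighter than any single
      root arc, so the minimum blocker \<open>H\<close> contains no root arc.\<close>
    have "B \<noteq> {}" if "union_arborescence G k B" for B
      using union_arborescence_card[OF G that v0 v] k by auto
    then have "blocks_optimal G c (union_arborescence G k) (arcs G)"
      using union_arborescence_subset unfolding blocks_optimal_def min_cost_def by blast
    then have "sum w2 H \<le> sum w (arcs G)" by (rule le)
    moreover have "sum w (arcs G) < sum w2 H" if "a \<in> H" "a \<in> R" for a
    proof -
      have "w2 a \<le> sum w2 H"
        using that finH HA w2_nonneg by (intro member_le_sum) auto
      then show ?thesis using w_root[OF that(2)] by simp
    qed
    ultimately have HR: "H \<inter> R = {}" by fastforce
    have "(H \<inter> arcs G) \<inter> B1 \<noteq> {}" if B1: "min_cost c (union_arborescence G k) B1" for B1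
    proof -
      \<comment> \<open>As \<open>H\<close> avoids \<open>R\<close> and \<open>B - R = B1\<close>,
        it can meet the extension \<open>B\<close> only inside \<open>B1\<close>.\<close>
      obtain B where B: "min_cost c2 (union_r_arborescence G2 r k) B" "B - R = B1"
        using min_cost_extend[OF B1] by blast
      have "H \<inter> B \<noteq> {}" using H B(1) by (simp add: blocks_optimal_def)
      moreover have "B1 \<subseteq> arcs G" using B1 union_arborescence_subset by (auto simp: min_cost_def)
      ultimately show ?thesis using B(2) HR by blast
    qed
    then show ?thesis using le wH order_trans unfolding blocks_optimal_def by blast
  qed
  have infeasible: "blocks_optimal G c (union_arborescence G k) (H \<inter> arcs G) \<and>
    (\<forall>H'. blocks_optimal G c (union_arborescence G k) H' \<longrightarrow> sum w (H \<inter> arcs G) \<le> sum w H')"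
    if no: "\<nexists>B0. union_arborescence G k B0"
  proof -
    \<comment> \<open>An optimal solution without penalty arcs would leave a
      \<open>k\<close>-union-arborescence of \<open>G\<close> once its root arcs are
      removed.\<close>
    have "P \<inter> B \<noteq> {}" if B: "min_cost c2 (union_r_arborescence G2 r k) B" for B
      using union_r_arborescence_remove_root_arcs[of B] min_cost_root_arcs[OF B] no B
      by (auto simp: min_cost_def)
    then have "blocks_optimal G2 c2 (union_r_arborescence G2 r k) P"
      by (auto simp: blocks_optimal_def arcs2)
    then have "sum w2 H \<le> sum w2 P" by (rule min)
    also have "sum w2 P = 0" using w_pen by simp
    finally have "sum w (H \<inter> arcs G) \<le> 0" using wH by simp
    moreover have "0 \<le> sum w H'" if "H' \<subseteq> arcs G" for H'
      using that w_nonneg by (intro sum_nonneg) auto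
    ultimately show ?thesis
      using no order_trans unfolding blocks_optimal_def min_cost_def by blast
  qed
  show "blocks_optimal G c (union_arborescence G k) (H \<inter> arcs G)"
    "\<And>H'. blocks_optimal G c (union_arborescence G k) H' \<Longrightarrow> sum w (H \<inter> arcs G) \<le> sum w H'"
    using feasible infeasible by blast+
qed

text \<open>Every optimal solution has \<open>k > 0\<close> root arcs and is therefore
  nonempty.\<close>

lemma blocker_exists: "blocks_optimal G2 c2 (union_r_arborescence G2 r k) (arcs G2)"
proof -
  have "arcs G2 \<inter> B \<noteq> {}" if B: "min_cost c2 (union_r_arborescence G2 r k) B" for B
  proof -
    have "B \<inter> R \<noteq> {}" using min_cost_root_arcs[OF B] k by auto
    then show ?thesis by (auto simp: arcs2)
  qed
  then show ?thesis by (simp add: blocks_optimal_def)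
qed

lemma ex_minimum_blocker:
  obtains H where "blocks_optimal G2 c2 (union_r_arborescence G2 r k) H"
    "\<And>H'. blocks_optimal G2 c2 (union_r_arborescence G2 r k) H' \<Longrightarrow> sum w2 H \<le> sum w2 H'"
proof -
  let ?U = "{H. blocks_optimal G2 c2 (union_r_arborescence G2 r k) H}"
  have "?U \<subseteq> Pow (arcs G2)" by (auto simp: blocks_optimal_def)
  then have "finite ?U" using finite_subset fin_digraph.finite_arcs[OF G2] by blast
  moreover have "?U \<noteq> {}" using blocker_exists by blast
  ultimately obtain H where "is_arg_min (sum w2) (\<lambda>H. H \<in> ?U) H"
    using ex_is_arg_min_if_finite by blast
  then show thesis using that by (auto simp: is_arg_min_linorder)
qed

end

section \<open>Running time of programs\<close>

text \<open>Weakest precondition for total correctness, whose postcondition also receives the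
  running time. With its rules used for rewriting, \<open>simp\<close> executes loop-free programs
  symbolically.\<close>

definition wp :: "(data \<Rightarrow> data) \<Rightarrow> com \<Rightarrow> (nat \<Rightarrow> store \<Rightarrow> bool) \<Rightarrow> store \<Rightarrow> bool" where
  "wp f c Q s \<longleftrightarrow> (\<exists>t s'. exec f c s t s' \<and> Q t s')"

lemma wp_Skip [simp]: "wp f Skip Q s \<longleftrightarrow> Q 1 s"
  unfolding wp_def by (subst exec.simps) auto

lemma wp_Assign [simp]: "wp f (Assign x e) Q s \<longleftrightarrow> Q 1 (s(x := eval e s))"
  unfolding wp_def by (subst exec.simps) auto

lemma wp_Query [simp]:
  "wp f (Query x e) Q s \<longleftrightarrow> Q (1 + data_size (eval e s)) (s(x := f (eval e s)))"
  unfolding wp_def by (subst exec.simps) auto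

lemma wp_Seq [simp]: "wp f (Seq c1 c2) Q s \<longleftrightarrow> wp f c1 (\<lambda>t1. wp f c2 (\<lambda>t2. Q (t1 + t2))) s"
  unfolding wp_def by (subst exec.simps) (auto, blast)

lemma wp_If [simp]:
  "wp f (If e c1 c2) Q s \<longleftrightarrow> wp f (if eval e s \<noteq> Null then c1 else c2) (\<lambda>t. Q (1 + t)) s"
  unfolding wp_def by (subst exec.simps) auto

text \<open>Kept out of the simpset since the loop recurs on the right; loops are handled by
  \<open>wp_for_loop\<close>.\<close>

lemma wp_While:
  "wp f (While e c) Q s \<longleftrightarrow>
    (if eval e s \<noteq> Null then wp f c (\<lambda>t1. wp f (While e c) (\<lambda>t2. Q (1 + t1 + t2))) s else Q 1 s)"
  unfolding wp_def by (subst exec.simps) (auto, blast)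

lemma wp_mono: "wp f c Q s \<Longrightarrow> (\<And>t s'. Q t s' \<Longrightarrow> Q' t s') \<Longrightarrow> wp f c Q' s"
  unfolding wp_def by blast

lemma computes_within_if_wp:
  "wp f c (\<lambda>t s'. t \<le> T \<and> s' 0 = y) ((\<lambda>_. Null)(0 := d)) \<Longrightarrow> computes_within f c d T y"
  unfolding wp_def computes_within_def by blast

text \<open>The trailing \<open>Skip\<close> takes one unit of time, which the time bounds
  include.\<close>

abbreviation seqs :: "com list \<Rightarrow> com" where
  "seqs cs \<equiv> foldr Seq cs Skip"

abbreviation joins :: "exp list \<Rightarrow> exp" where
  "joins es \<equiv> foldr Join es Empty"

section \<open>Sizes of encodings\<close>

lemma data_size_enc_arc [simp]: "data_size (enc_arc G c w a) = 11"
  by (simp add: enc_arc_def enc_nat_def)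

lemma data_size_enc_nats [simp]: "data_size (enc_list (map enc_nat xs)) = 1 + 2 * length xs"
  by (induction xs) (auto simp: enc_nat_def)

lemma data_size_enc_arcs [simp]: "data_size (enc_list (map (enc_arc G c w) xs)) = 1 + 12 * length xs"
  by (induction xs) auto

abbreviation arc_head :: "exp \<Rightarrow> exp" where "arc_head e \<equiv> Fst (Snd (Snd e))"

abbreviation arc_cost :: "exp \<Rightarrow> exp" where "arc_cost e \<equiv> Fst (Snd (Snd (Snd e)))"

abbreviation arc_weight :: "exp \<Rightarrow> exp" where "arc_weight e \<equiv> Fst (Snd (Snd (Snd (Snd e))))"


text \<open>\<open>\<sigma> j\<close> is the exact store before round \<open>j\<close>. A round
  costs one unit for the test and at most \<open>b\<close> for the body, and the final test costs
  one more.\<close>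

lemma wp_for_loop:
  fixes \<sigma> :: "nat \<Rightarrow> store"
  assumes "\<And>j. j < n \<Longrightarrow> eval e (\<sigma> j) \<noteq> Null" "eval e (\<sigma> n) = Null"
    and step: "\<And>j. j < n \<Longrightarrow> wp f body (\<lambda>t s'. t \<le> b \<and> s' = \<sigma> (Suc j)) (\<sigma> j)"
    and s: "s = \<sigma> 0" and Q: "\<And>t. t \<le> 1 + (1 + b) * n \<Longrightarrow> Q t (\<sigma> n)"
  shows "wp f (While e body) Q s"
proof -
  have "wp f (While e body) (\<lambda>t s'. t \<le> 1 + (1 + b) * (n - j) \<and> s' = \<sigma> n) (\<sigma> j)" if "j \<le> n" for j
    using that
  proof (induction rule: inc_induct)
    case base
    show ?case using assms(2) by (simp add: wp_While)
  next
    case (step j)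
    have "1 + (1 + b) * (n - j) = 1 + b + (1 + (1 + b) * (n - Suc j))"
      using Suc_diff_Suc[OF step.hyps(2)] by (metis add.left_commute mult_Suc_right)
    then have "wp f body (\<lambda>t1. wp f (While e body)
        (\<lambda>t2 s'. 1 + t1 + t2 \<le> 1 + (1 + b) * (n - j) \<and> s' = \<sigma> n)) (\<sigma> j)"
      using assms(3)[OF step.hyps(2)] step.IH
      by (elim wp_mono) (auto elim!: wp_mono)
    then show ?case using assms(1)[OF step.hyps(2)] by (subst wp_While) simp
  qed
  from this[of 0] show ?thesis using Q s by (auto elim: wp_mono)
qed

section \<open>Loops over encoded lists\<close>

lemma enc_list_drop:
  assumes "j < length xs"
  shows "enc_list (map g (drop j xs)) = Node (g (xs ! j)) (enc_list (map g (drop (Suc j) xs)))"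
  using assms by (simp flip: Cons_nth_drop_Suc)

text \<open>Equality of numbers is tested by two comparisons, as the language has only
  \<open>LessEq\<close>. Kept arcs are put in front, which reverses the list.\<close>

definition drop_arcs_into :: com where
  "drop_arcs_into = While (Var 1) (seqs
    [If (LessEq (arc_head (Fst (Var 1))) (Var 2))
       (If (LessEq (Var 2) (arc_head (Fst (Var 1)))) Skip (Assign 3 (Join (Fst (Var 1)) (Var 3))))
       (Assign 3 (Join (Fst (Var 1)) (Var 3))),
     Assign 1 (Snd (Var 1))])"

lemma wp_drop_arcs_into:
  assumes "s 1 = enc_list (map (enc_arc G c w) as)" "s 2 = enc_nat r" "s 3 = Null"
    and "\<And>t. t \<le> 1 + 6 * length as \<Longrightarrow>
      Q t (s(1 := Null, 3 := enc_list (map (enc_arc G c w) (rev (filter (\<lambda>a. head G a \<noteq> r) as)))))"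
  shows "wp f drop_arcs_into Q s"
  unfolding drop_arcs_into_def
  by (rule wp_for_loop[where n = "length as" and b = 5 and
      \<sigma> = "\<lambda>j. s(1 := enc_list (map (enc_arc G c w) (drop j as)),
        3 := enc_list (map (enc_arc G c w) (rev (filter (\<lambda>a. head G a \<noteq> r) (take j as)))))"])
    (use assms in \<open>auto simp: enc_list_drop enc_arc_def enc_nat_def take_Suc_conv_app_nth fun_eq_iff\<close>)

text \<open>The sums in variables 5, 6 and 7 start at one, so that they end strictly above the total
  absolute cost, the total weight and every arc name.\<close>

definition scan_arcs :: com where
  "scan_arcs = While (Var 3) (seqs
    [Assign 4 (Plus (Var 4) (Lit 1)),
     If (LessEq (Lit 0) (arc_cost (Fst (Var 3))))
       (Assign 5 (Plus (Var 5) (arc_cost (Fst (Var 3)))))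
       (Assign 5 (Minus (Var 5) (arc_cost (Fst (Var 3))))),
     Assign 6 (Plus (Var 6) (arc_weight (Fst (Var 3)))),
     Assign 7 (Plus (Var 7) (Fst (Fst (Var 3)))),
     Assign 3 (Snd (Var 3))])"

lemma wp_scan_arcs:
  assumes "s 3 = enc_list (map (enc_arc G c w) as)"
    "s 4 = Num 0" "s 5 = Num 1" "s 6 = Num 1" "s 7 = Num 1"
    and "\<And>t. t \<le> 1 + 8 * length as \<Longrightarrow>
      Q t (s(3 := Null, 4 := Num (length as), 5 := Num (1 + (\<Sum>a\<leftarrow>as. \<bar>c a\<bar>)),
        6 := Num (1 + (\<Sum>a\<leftarrow>as. w a)), 7 := enc_nat (1 + sum_list as)))"
  shows "wp f scan_arcs Q s"
  unfolding scan_arcs_def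
  by (rule wp_for_loop[where n = "length as" and b = 7 and
      \<sigma> = "\<lambda>j. s(3 := enc_list (map (enc_arc G c w) (drop j as)), 4 := Num j,
        5 := Num (1 + (\<Sum>a\<leftarrow>take j as. \<bar>c a\<bar>)), 6 := Num (1 + (\<Sum>a\<leftarrow>take j as. w a)),
        7 := enc_nat (1 + sum_list (take j as)))"])
    (use assms in \<open>auto simp: enc_list_drop enc_arc_def enc_nat_def take_Suc_conv_app_nth fun_eq_iff\<close>)

definition scan_nodes :: com where
  "scan_nodes = While (Var 3) (seqs [Assign 8 (Plus (Var 8) (Fst (Var 3))), Assign 3 (Snd (Var 3))])"

lemma wp_scan_nodes:
  assumes "s 3 = enc_list (map enc_nat vs)" "s 8 = Num 1"
    and "\<And>t. t \<le> 1 + 4 * length vs \<Longrightarrow> Q t (s(3 := Null, 8 := enc_nat (1 + sum_list vs)))"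
  shows "wp f scan_nodes Q s"
  unfolding scan_nodes_def
  by (rule wp_for_loop[where n = "length vs" and b = 3 and
      \<sigma> = "\<lambda>j. s(3 := enc_list (map enc_nat (drop j vs)), 8 := enc_nat (1 + sum_list (take j vs)))"])
    (use assms in \<open>auto simp: enc_list_drop enc_nat_def take_Suc_conv_app_nth fun_eq_iff\<close>)

text \<open>Names are integers, so \<open>h < N\<close> is tested as \<open>h + 1 \<le> N\<close>.
  This strips the new arcs, whose names start at \<open>N\<close>, from the oracle's answer.\<close>

definition keep_less :: com where
  "keep_less = While (Var 16) (seqs
    [If (LessEq (Plus (Fst (Var 16)) (Lit 1)) (Var 15)) (Assign 0 (Join (Fst (Var 16)) (Var 0))) Skip,
     Assign 16 (Snd (Var 16))])"

lemma wp_keep_less: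
  assumes "s 16 = enc_list (map enc_nat hs)" "s 15 = enc_nat N" "s 0 = Null"
    and "\<And>t. t \<le> 1 + 5 * length hs \<Longrightarrow>
      Q t (s(16 := Null, 0 := enc_list (map enc_nat (rev (filter (\<lambda>h. h < N) hs)))))"
  shows "wp f keep_less Q s"
  unfolding keep_less_def
  by (rule wp_for_loop[where n = "length hs" and b = 4 and
      \<sigma> = "\<lambda>j. s(16 := enc_list (map enc_nat (drop j hs)),
        0 := enc_list (map enc_nat (rev (filter (\<lambda>h. h < N) (take j hs)))))"])
    (use assms in \<open>auto simp: enc_list_drop enc_nat_def take_Suc_conv_app_nth fun_eq_iff\<close>)

definition arc_data :: "nat \<Rightarrow> nat \<Rightarrow> nat \<Rightarrow> real \<Rightarrow> real \<Rightarrow> data" where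
  "arc_data a t h c w = enc_list [enc_nat a, enc_nat t, enc_nat h, Num c, Num w]"

text \<open>The language has no multiplication. Variable 12 therefore adds up the costs of the arcs
  put in, and holds the cost of a root arc once the penalty star is complete.\<close>

definition add_copies :: com where
  "add_copies = While (LessEq (Lit 1) (Var 14)) (seqs
    [Assign 13 (Join (joins [Var 7, Var 9, Fst (Var 3), Var 10, Var 11]) (Var 13)),
     Assign 7 (Plus (Var 7) (Lit 1)),
     Assign 12 (Plus (Var 12) (Var 10)),
     Assign 14 (Minus (Var 14) (Lit 1))])"

lemma wp_add_copies:
  fixes c w m :: real
  assumes "s 3 = Node (enc_nat v) d" "s 14 = enc_nat k" "s 7 = enc_nat N" "s 9 = enc_nat u"
    "s 10 = Num c" "s 11 = Num w" "s 12 = Num m" "s 13 = enc_list ds"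
    and "\<And>t. t \<le> 1 + 6 * k \<Longrightarrow>
      Q t (s(7 := enc_nat (N + k), 12 := Num (m + k * c),
        13 := enc_list (map (\<lambda>a. arc_data a u v c w) (rev [N..<N + k]) @ ds), 14 := Num 0))"
  shows "wp f add_copies Q s"
  unfolding add_copies_def
  by (rule wp_for_loop[where n = k and b = 5 and
      \<sigma> = "\<lambda>i. s(7 := enc_nat (N + i), 12 := Num (m + i * c),
        13 := enc_list (map (\<lambda>a. arc_data a u v c w) (rev [N..<N + i]) @ ds), 14 := Num (real k - i))"])
    (use assms in \<open>auto simp: arc_data_def enc_nat_def algebra_simps fun_eq_iff\<close>)

definition add_star :: com where
  "add_star = While (Var 3) (seqs [Assign 14 (Var 2), add_copies, Assign 3 (Snd (Var 3))])"

text \<open>Each round leaves the countdown in variable 14 at 0; requiring 0 at the start too gives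
  the stores between rounds one uniform description. \<open>h\<close> maps the name of a new arc to
  its head.\<close>

lemma wp_add_star:
  fixes c w m :: real
  assumes s: "s 3 = enc_list (map enc_nat vs)" "s 2 = enc_nat k" "s 14 = Num 0" "s 7 = enc_nat N"
    "s 9 = enc_nat u" "s 10 = Num c" "s 11 = Num w" "s 12 = Num m" "s 13 = enc_list ds"
    and h: "\<And>j i. j < length vs \<Longrightarrow> i < k \<Longrightarrow> h (N + j * k + i) = vs ! j"
    and Q: "\<And>t. t \<le> 1 + (5 + 6 * k) * length vs \<Longrightarrow>
      Q t (s(3 := Null, 7 := enc_nat (N + length vs * k), 12 := Num (m + (length vs * k) * c),
        13 := enc_list (map (\<lambda>a. arc_data a u (h a) c w) (rev [N..<N + length vs * k]) @ ds)))"
  shows "wp f add_star Q s"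
  unfolding add_star_def
proof (rule wp_for_loop[where n = "length vs" and b = "4 + 6 * k" and
      \<sigma> = "\<lambda>j. s(3 := enc_list (map enc_nat (drop j vs)),
        7 := enc_nat (N + j * k), 12 := Num (m + (j * k) * c),
        13 := enc_list (map (\<lambda>a. arc_data a u (h a) c w) (rev [N..<N + j * k]) @ ds))"])
  fix j assume j: "j < length vs"
  have "map (\<lambda>a. arc_data a u (h a) c w) [N + j * k..<N + j * k + k] =
      map (\<lambda>a. arc_data a u (vs ! j) c w) [N + j * k..<N + j * k + k]"
    using h[OF j] by (auto simp: le_iff_add)
  moreover have "[N..<N + Suc j * k] = [N..<N + j * k] @ [N + j * k..<N + j * k + k]"
    using upt_add_eq_append[of N "N + j * k" k] by (simp add: algebra_simps)
  ultimately have *: "map (\<lambda>a. arc_data a u (h a) c w) (rev [N..<N + Suc j * k]) =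
      map (\<lambda>a. arc_data a u (vs ! j) c w) (rev [N + j * k..<N + j * k + k]) @
      map (\<lambda>a. arc_data a u (h a) c w) (rev [N..<N + j * k])"
    by (simp flip: rev_map)
  show "wp f (seqs [Assign 14 (Var 2), add_copies, Assign 3 (Snd (Var 3))])
    (\<lambda>t s'. t \<le> 4 + 6 * k \<and> s' = s(3 := enc_list (map enc_nat (drop (Suc j) vs)),
        7 := enc_nat (N + Suc j * k), 12 := Num (m + (Suc j * k) * c),
        13 := enc_list (map (\<lambda>a. arc_data a u (h a) c w) (rev [N..<N + Suc j * k]) @ ds)))
    (s(3 := enc_list (map enc_nat (drop j vs)),
        7 := enc_nat (N + j * k), 12 := Num (m + (j * k) * c),
        13 := enc_list (map (\<lambda>a. arc_data a u (h a) c w) (rev [N..<N + j * k]) @ ds)))"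
    using s j unfolding *
    by simp (rule wp_add_copies[where v = "vs ! j" and k = k and N = "N + j * k" and u = u and c = c
        and w = w and m = "m + (j * k) * c" and
        ds = "map (\<lambda>a. arc_data a u (h a) c w) (rev [N..<N + j * k]) @ ds"],
        auto simp: enc_list_drop fun_eq_iff algebra_simps)
qed (use s Q in \<open>auto simp: enc_list_drop fun_eq_iff\<close>)

section \<open>The reductions\<close>

text \<open>For an oracle answer that is returned unchanged. The last assumption covers the report
  \<open>Num 0\<close>: if the first problem has no optimum, neither has the second.\<close>

lemma correct_answer_transfer:
  assumes "correct_answer P i y" "\<And>H. optimal P i H \<Longrightarrow> optimal Q j H"
    and "\<And>H. optimal Q j H \<Longrightarrow> \<exists>H'. optimal P i H'"
  shows "correct_answer Q j y"
  using assms unfolding correct_answer_def by (metis (full_types))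

lemma poly_time_reducibleI:
  assumes "\<And>f i d. solves f Q \<Longrightarrow> i \<in> instances P \<Longrightarrow> encodes P i d \<Longrightarrow>
    \<exists>y. wp f c (\<lambda>t s'. t \<le> poly p (data_size d) \<and> s' 0 = y) ((\<lambda>_. Null)(0 := d)) \<and>
      correct_answer P i y"
  shows "poly_time_reducible P Q"
  unfolding poly_time_reducible_def
  using assms computes_within_if_wp by blast

section \<open>From the rooted to the unrooted problem\<close>

definition delete_arcs_into :: "('a, 'b) pre_digraph \<Rightarrow> 'a \<Rightarrow> ('a, 'b) pre_digraph" where
  "delete_arcs_into G r = G\<lparr>arcs := {a \<in> arcs G. head G a \<noteq> r}\<rparr>"

lemma fin_digraph_delete_arcs_into:
  assumes "fin_digraph G"
  shows "fin_digraph (delete_arcs_into G r)"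
proof -
  interpret fin_digraph G by fact
  show ?thesis by unfold_locales (auto simp: delete_arcs_into_def)
qed

text \<open>A root other than \<open>r\<close> would need an arc entering \<open>r\<close>, and
  these are deleted; conversely \<open>r\<close>-arborescences contain none of them.\<close>

lemma spanning_arborescence_delete_arcs_into:
  assumes G: "fin_digraph G" and r: "r \<in> verts G"
  shows "(\<exists>v. spanning_arborescence (delete_arcs_into G r) v B) \<longleftrightarrow> spanning_arborescence G r B"
proof -
  note iffs = spanning_arborescence_iff[OF G]
    spanning_arborescence_iff[OF fin_digraph_delete_arcs_into[OF G]]
  have "ends (delete_arcs_into G r) B = ends G B"
    by (simp add: ends_def delete_arcs_into_def)
  then have same: "spanning_arborescence (delete_arcs_into G r) r B \<longleftrightarrow> spanning_arborescence G r B"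
    unfolding iffs by (auto simp: delete_arcs_into_def)
  have "v = r" if B: "spanning_arborescence (delete_arcs_into G r) v B" for v
  proof (rule ccontr)
    assume "v \<noteq> r"
    then obtain a where "a \<in> B" "head G a = r"
      using B r unfolding iffs by (auto simp: delete_arcs_into_def)
    then show False using B unfolding iffs by (auto simp: delete_arcs_into_def)
  qed
  then show ?thesis using same by blast
qed

lemma union_arborescence_delete_arcs_into:
  assumes "fin_digraph G" "r \<in> verts G"
  shows "union_arborescence (delete_arcs_into G r) k = union_r_arborescence G r k"
  unfolding union_arborescence_def union_r_arborescence_def
    spanning_arborescence_delete_arcs_into[OF assms] ..

text \<open>Both digraphs have the same optimal solutions, all within \<open>arcs D\<close>, so the
  part of a blocker outside \<open>arcs D\<close> hits nothing.\<close>

lemma blocks_optimal_delete_arcs_into: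
  assumes G: "fin_digraph G" "r \<in> verts G"
  defines "D \<equiv> delete_arcs_into G r"
  shows "blocks_optimal D c (union_arborescence D k) H \<Longrightarrow>
      blocks_optimal G c (union_r_arborescence G r k) H"
    and "blocks_optimal G c (union_r_arborescence G r k) H \<Longrightarrow>
      blocks_optimal D c (union_arborescence D k) (H \<inter> arcs D)"
proof -
  note eq = union_arborescence_delete_arcs_into[OF G, of k, folded D_def]
  have sub: "arcs D \<subseteq> arcs G" by (auto simp: D_def delete_arcs_into_def)
  show "blocks_optimal D c (union_arborescence D k) H \<Longrightarrow>
      blocks_optimal G c (union_r_arborescence G r k) H"
    using sub unfolding blocks_optimal_def eq by blast
  have "B \<subseteq> arcs D" if "min_cost c (union_r_arborescence G r k) B" for B
    using that union_arborescence_subset[of D k B] unfolding eq by (simp add: min_cost_def)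
  then show "blocks_optimal G c (union_r_arborescence G r k) H \<Longrightarrow>
      blocks_optimal D c (union_arborescence D k) (H \<inter> arcs D)"
    unfolding blocks_optimal_def eq by blast
qed

definition rooted_to_unrooted :: com where
  "rooted_to_unrooted = seqs
    [Assign 1 (Fst (Snd (Var 0))), Assign 2 (Fst (Snd (Snd (Var 0)))), Assign 3 Empty,
     drop_arcs_into,
     Query 0 (joins [Fst (Var 0), Var 3, Fst (Snd (Snd (Snd (Var 0))))])]"

lemma rooted_reducible_to_unrooted:
  "poly_time_reducible blocking_union_r_arborescences blocking_union_arborescences"
proof (rule poly_time_reducibleI[where c = rooted_to_unrooted and p = "[:20, 10:]"])
  fix f i d
  assume f: "solves f blocking_union_arborescences"
    and i: "i \<in> instances blocking_union_r_arborescences"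
    and d: "encodes blocking_union_r_arborescences i d"
  obtain G r k c w where i': "i = (G, r, k, c, w)" by (cases i)
  then have G: "fin_digraph G" and r: "r \<in> verts G" and k: "k > 0"
    and w: "\<And>a. a \<in> arcs G \<Longrightarrow> w a \<ge> 0"
    using i by (auto simp: blocking_union_r_arborescences_def)
  obtain vs as where vs: "distinct vs" "set vs = verts G" and as: "distinct as" "set as = arcs G"
    and d': "d = enc_list [enc_list (map enc_nat vs), enc_list (map (enc_arc G c w) as),
      enc_nat r, enc_nat k]"
    using d i' by (auto simp: blocking_union_r_arborescences_def encodes_set_def encodes_arcs_def)
  define D where "D = delete_arcs_into G r"
  define as' where "as' = rev (filter (\<lambda>a. head G a \<noteq> r) as)"
  define q where "q = enc_list [enc_list (map enc_nat vs), enc_list (map (enc_arc G c w) as'), enc_nat k]"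
  have len: "length as' \<le> length as" by (simp add: as'_def)
  \<comment> \<open>The loop is linear in the number of arcs and the query is no larger than the
    input, so a linear bound suffices.\<close>
  have time: "wp f rooted_to_unrooted (\<lambda>t s'. t \<le> poly [:20, 10:] (data_size d) \<and> s' 0 = f q)
      ((\<lambda>_. Null)(0 := d))"
    unfolding rooted_to_unrooted_def
    apply (simp add: d')
    apply (rule wp_drop_arcs_into[where G = G and c = c and w = w and as = as and r = r])
    using len by (auto simp: q_def as'_def[symmetric] enc_nat_def)
  have arcsD: "arcs D \<subseteq> arcs G" by (auto simp: D_def delete_arcs_into_def)
  let ?j = "(D, k, c, w)"
  have j: "?j \<in> instances blocking_union_arborescences"
    using fin_digraph_delete_arcs_into[OF G] k w arcsD
    by (auto simp: blocking_union_arborescences_def D_def)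
  have "enc_arc G c w = enc_arc D c w"
    by (simp add: fun_eq_iff enc_arc_def D_def delete_arcs_into_def)
  moreover have "distinct as'" "set as' = arcs D"
    using as by (auto simp: as'_def D_def delete_arcs_into_def)
  moreover have "verts D = verts G" by (simp add: D_def delete_arcs_into_def)
  ultimately have "encodes blocking_union_arborescences ?j q"
    using vs unfolding q_def blocking_union_arborescences_def encodes_set_def encodes_arcs_def
    by auto
  then have ans: "correct_answer blocking_union_arborescences ?j (f q)"
    using f j by (auto simp: solves_def)
  note blocks = blocks_optimal_delete_arcs_into[OF G r, folded D_def]
  \<comment> \<open>Since weights are nonnegative, discarding deleted arcs from a blocker does not
    make it heavier.\<close>
  have le: "sum w (H \<inter> arcs D) \<le> sum w H" if "H \<subseteq> arcs G" for H
    using that w fin_digraph.finite_arcs[OF G] finite_subset[of H]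
    by (intro sum_mono2) auto
  have "correct_answer blocking_union_r_arborescences i (f q)"
    using ans
  proof (rule correct_answer_transfer)
    fix H assume "optimal blocking_union_arborescences ?j H"
    then have H: "blocks_optimal D c (union_arborescence D k) H"
      and min: "\<And>H'. blocks_optimal D c (union_arborescence D k) H' \<Longrightarrow> sum w H \<le> sum w H'"
      by (auto simp: optimal_def blocking_union_arborescences_def)
    have "sum w H \<le> sum w H'" if "blocks_optimal G c (union_r_arborescence G r k) H'" for H'
      using min[OF blocks(2)[OF that]] le[of H'] that by (simp add: blocks_optimal_def)
    then show "optimal blocking_union_r_arborescences i H"
      using blocks(1)[OF H] by (auto simp: optimal_def blocking_union_r_arborescences_def i')
  next
    fix H assume "optimal blocking_union_r_arborescences i H"
    then have H: "blocks_optimal G c (union_r_arborescence G r k) H"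
      and min: "\<And>H'. blocks_optimal G c (union_r_arborescence G r k) H' \<Longrightarrow> sum w H \<le> sum w H'"
      by (auto simp: optimal_def blocking_union_r_arborescences_def i')
    have "sum w (H \<inter> arcs D) \<le> sum w H'" if "blocks_optimal D c (union_arborescence D k) H'" for H'
      using min[OF blocks(1)[OF that]] le[of H] H by (simp add: blocks_optimal_def)
    then have "optimal blocking_union_arborescences ?j (H \<inter> arcs D)"
      using blocks(2)[OF H] by (auto simp: optimal_def blocking_union_arborescences_def)
    then show "\<exists>H'. optimal blocking_union_arborescences ?j H'" by blast
  qed
  then show "\<exists>y. wp f rooted_to_unrooted (\<lambda>t s'. t \<le> poly [:20, 10:] (data_size d) \<and> s' 0 = y)
      ((\<lambda>_. Null)(0 := d)) \<and> correct_answer blocking_union_r_arborescences i y"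
    using time by blast
qed

section \<open>The extension with numbered arcs\<close>

text \<open>New arcs are named from \<open>N\<close> on in two blocks, penalty arcs before root
  arcs. A block runs through \<open>vs\<close> with \<open>k\<close> consecutive names per node:
  division by \<open>k\<close> gives the position of the head, and \<open>mod\<close> undoes the
  offset of the second block.\<close>

definition ext_graph :: "(nat, nat) pre_digraph \<Rightarrow> nat list \<Rightarrow> nat \<Rightarrow> nat \<Rightarrow> nat \<Rightarrow> (nat, nat) pre_digraph" where
  "ext_graph G vs k N r = \<lparr>
     verts = insert r (verts G),
     arcs = arcs G \<union> {N..<N + length vs * k} \<union> {N + length vs * k..<N + 2 * (length vs * k)},
     tail = (\<lambda>a. if a < N then tail G a else if a < N + length vs * k then hd vs else r),
     head = (\<lambda>a. if a < N then head G a else vs ! ((a - N) div k mod length vs))\<rparr>"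

text \<open>Serves for costs and weights alike: \<open>n\<close> is the length of a block,
  \<open>x\<close> the value on penalty arcs and \<open>y\<close> that on root arcs.\<close>

definition ext_fun :: "(nat \<Rightarrow> real) \<Rightarrow> nat \<Rightarrow> nat \<Rightarrow> real \<Rightarrow> real \<Rightarrow> nat \<Rightarrow> real" where
  "ext_fun g N n x y a = (if a < N then g a else if a < N + n then x else y)"

text \<open>Division of \<open>a - N\<close> by \<open>k\<close>: the quotient is the position of
  the node, the remainder the index of the copy.\<close>

lemma interval_eq_image:
  fixes N k :: nat
  assumes pos: "\<And>v. v \<in> set vs \<Longrightarrow> pos v < length vs \<and> vs ! pos v = v"
    and "distinct vs" "k > 0"
  shows "{N..<N + length vs * k} = (\<lambda>(v, i). N + pos v * k + i) ` (set vs \<times> {..<k})"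
proof (intro set_eqI iffI)
  fix a assume a: "a \<in> {N..<N + length vs * k}"
  define j where "j = (a - N) div k"
  have j: "j < length vs" using a \<open>k > 0\<close> by (auto simp: j_def less_mult_imp_div_less)
  then have "pos (vs ! j) = j"
    using pos[of "vs ! j"] \<open>distinct vs\<close> nth_eq_iff_index_eq by fastforce
  then have "a = N + pos (vs ! j) * k + (a - N) mod k"
    using a by (simp add: j_def add.assoc)
  then show "a \<in> (\<lambda>(v, i). N + pos v * k + i) ` (set vs \<times> {..<k})"
    using j \<open>k > 0\<close> by (intro image_eqI[where x = "(vs ! j, (a - N) mod k)"]) auto
next
  fix a assume "a \<in> (\<lambda>(v, i). N + pos v * k + i) ` (set vs \<times> {..<k})"
  then obtain v i where vi: "v \<in> set vs" "i < k" "a = N + pos v * k + i" by auto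
  have "pos v * k + i < (pos v + 1) * k" using vi by simp
  also have "\<dots> \<le> length vs * k" using pos[OF vi(1)] by (intro mult_right_mono) auto
  finally show "a \<in> {N..<N + length vs * k}" using vi(3) by simp
qed

lemma root_extension_ext_graph:
  fixes G :: "(nat, nat) pre_digraph" and c w :: "nat \<Rightarrow> real" and L M W :: real
  assumes G: "fin_digraph G" and vs: "distinct vs" "set vs = verts G" "length vs \<ge> 2"
    and k: "k > 0" and r: "r \<notin> verts G" and N: "\<And>a. a \<in> arcs G \<Longrightarrow> a < N"
    and w: "\<And>a. a \<in> arcs G \<Longrightarrow> w a \<ge> 0"
    and L: "L > 2 * (\<Sum>a\<in>arcs G. \<bar>c a\<bar>)"
    and M: "M > L * (length vs * k) + (\<Sum>a\<in>arcs G. \<bar>c a\<bar>)"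
    and W: "W > (\<Sum>a\<in>arcs G. w a)"
  obtains pen root where "root_extension G (ext_graph G vs k N r) r (hd vs) k pen root
    c (ext_fun c N (length vs * k) L M) w (ext_fun w N (length vs * k) 0 W) L M
    {N..<N + length vs * k} {N + length vs * k..<N + 2 * (length vs * k)}"
proof -
  let ?n = "length vs"
  have "\<forall>v\<in>set vs. \<exists>j. j < ?n \<and> vs ! j = v" by (auto simp: in_set_conv_nth)
  \<comment> \<open>\<open>pos\<close> inverts the indexing of \<open>vs\<close> and so turns block
    positions into names indexed by nodes, as the locale expects.\<close>
  then obtain pos where pos: "\<And>v. v \<in> set vs \<Longrightarrow> pos v < ?n \<and> vs ! pos v = v" by metis
  define pen where "pen v i = N + pos v * k + i" for v i
  define root where "root v i = N + ?n * k + pos v * k + i" for v i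
  have P: "{N..<N + ?n * k} = (\<lambda>(v, i). pen v i) ` (verts G \<times> {..<k})"
    using interval_eq_image[OF pos vs(1) k, of N] by (simp add: pen_def vs)
  have R: "{N + ?n * k..<N + 2 * (?n * k)} = (\<lambda>(v, i). root v i) ` (verts G \<times> {..<k})"
    using interval_eq_image[OF pos vs(1) k, of "N + ?n * k"] by (simp add: root_def vs mult_2 add.assoc)
  have penP: "N \<le> pen v i \<and> pen v i < N + ?n * k" if "v \<in> verts G" "i < k" for v i
    using P that by (metis (mono_tags, lifting) SigmaI atLeastLessThan_iff case_prod_conv image_eqI lessThan_iff)
  have head_pen: "head (ext_graph G vs k N r) (pen v i) = v" if "v \<in> verts G" "i < k" for v i
    using that pos[of v] vs k by (simp add: ext_graph_def pen_def add.assoc)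
  have head_root: "head (ext_graph G vs k N r) (root v i) = v" if "v \<in> verts G" "i < k" for v i
  proof -
    have "(root v i - N) div k mod ?n = ((?n + pos v) * k + i) div k mod ?n"
      by (simp add: root_def algebra_simps)
    also have "\<dots> = pos v" using that pos[of v] vs k by simp
    finally show ?thesis using that pos[of v] vs by (simp add: ext_graph_def root_def)
  qed
  have hd: "hd vs \<in> verts G" using vs by (metis hd_in_set length_0_conv not_numeral_le_zero)
  have two: "\<exists>v\<in>verts G. v \<noteq> hd vs"
  proof -
    obtain x y zs where "vs = x # y # zs" using vs(3) by (auto simp: Suc_le_length_iff numeral_2_eq_2)
    then show ?thesis using vs by auto
  qed
  have wfG: "wf_digraph G" and finG: "finite (verts G)" "finite (arcs G)"
    using G by (auto simp: fin_digraph.finite_arcs fin_digraph.finite_verts fin_digraph.axioms)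
  have G2: "fin_digraph (ext_graph G vs k N r)"
  proof
    fix e assume e: "e \<in> arcs (ext_graph G vs k N r)"
    show "tail (ext_graph G vs k N r) e \<in> verts (ext_graph G vs k N r)"
      using e hd N wf_digraph.tail_in_verts[OF wfG] by (auto simp: ext_graph_def)
    have "e \<in> arcs G \<or> (\<exists>v\<in>verts G. \<exists>i<k. e = pen v i \<or> e = root v i)"
      using e P R by (fastforce simp: ext_graph_def)
    then show "head (ext_graph G vs k N r) e \<in> verts (ext_graph G vs k N r)"
    proof
      assume "e \<in> arcs G"
      then show ?thesis using N wf_digraph.head_in_verts[OF wfG] by (auto simp: ext_graph_def)
    next
      assume "\<exists>v\<in>verts G. \<exists>i<k. e = pen v i \<or> e = root v i"
      then have "head (ext_graph G vs k N r) e \<in> verts G" using head_pen head_root by auto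
      then show ?thesis by (simp add: ext_graph_def)
    qed
  qed (use finG in \<open>auto simp: ext_graph_def\<close>)
  \<comment> \<open>Names in a block, less its offset, have the copy index as remainder modulo
    \<open>k\<close>.\<close>
  have inj: "i = j" if "m + p * k + i = m + q * k + j" "i < k" "j < k" for m p q i j :: nat
    using that by (metis add.assoc add_left_cancel mod_less mod_mult_self3)
  have "root_extension G (ext_graph G vs k N r) r (hd vs) k pen root
    c (ext_fun c N (?n * k) L M) w (ext_fun w N (?n * k) 0 W) L M
    {N..<N + ?n * k} {N + ?n * k..<N + 2 * (?n * k)}"
    using P R G G2 hd r k two
  proof (rule root_extension.intro)
    show "\<And>v i. v \<in> verts G \<Longrightarrow> i < k \<Longrightarrow> tail (ext_graph G vs k N r) (pen v i) = hd vs"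
      using penP by (fastforce simp: ext_graph_def)
    show "\<And>v i. v \<in> verts G \<Longrightarrow> i < k \<Longrightarrow> tail (ext_graph G vs k N r) (root v i) = r"
      by (simp add: ext_graph_def root_def)
    show "\<And>u i v j. pen u i = pen v j \<Longrightarrow> u \<in> verts G \<Longrightarrow> v \<in> verts G \<Longrightarrow> i < k \<Longrightarrow> j < k \<Longrightarrow> i = j"
      unfolding pen_def by (rule inj)
    show "\<And>u i v j. root u i = root v j \<Longrightarrow> u \<in> verts G \<Longrightarrow> v \<in> verts G \<Longrightarrow> i < k \<Longrightarrow> j < k \<Longrightarrow> i = j"
      unfolding root_def by (rule inj)
    show "M > L * card {N..<N + ?n * k} + (\<Sum>a\<in>arcs G. \<bar>c a\<bar>)" using M by simp
  qed (use head_pen head_root L W w in \<open>auto simp: ext_graph_def ext_fun_def dest: N\<close>)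
  then show thesis by (rule that)
qed

text \<open>
  Variables of the program: 2 the number \<open>k\<close>, 3 a list being scanned, 4 the number of arcs,
  5 one plus the total absolute cost, 6 one plus the total weight, 7 the next fresh arc name,
  8 the new root, 9, 10 and 11 tail, cost and weight of the star being added, 12 the cost of a
  root arc, 13 the arc list under construction, 14 a countdown, 15 the first new arc name,
  16 the oracle's answer, 17 the node list.
\<close>

definition query_extension :: com where
  "query_extension = seqs
    [Assign 15 (Var 7), Assign 3 (Var 17), Assign 8 (Lit 1), scan_nodes,
     Assign 12 (Var 5), Assign 9 (Fst (Var 17)), Assign 10 (Plus (Var 5) (Var 5)),
     Assign 11 (Lit 0), Assign 14 (Lit 0), Assign 3 (Var 17), add_star,
     Assign 9 (Var 8), Assign 10 (Var 12), Assign 11 (Var 6), Assign 3 (Var 17), add_star,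
     Query 16 (joins [Join (Var 8) (Var 17), Var 13, Var 8, Var 2]),
     Assign 0 Empty, keep_less]"

text \<open>\<open>Var 17\<close> and \<open>Snd (Var 17)\<close> test for at least one and at least
  two nodes. The answer \<open>Empty\<close> is the empty blocker, for instances without a
  \<open>k\<close>-union-arborescence; \<open>Lit 0\<close> reports that with a single node there is
  no blocker.\<close>

definition unrooted_to_rooted :: com where
  "unrooted_to_rooted = Seq (Assign 17 (Fst (Var 0))) (If (Var 17) (If (Snd (Var 17))
     (seqs
       [Assign 3 (Fst (Snd (Var 0))), Assign 13 (Var 3), Assign 2 (Fst (Snd (Snd (Var 0)))),
        Assign 4 (Lit 0), Assign 5 (Lit 1), Assign 6 (Lit 1), Assign 7 (Lit 1), scan_arcs,
        If (LessEq (Var 2) (Var 4)) query_extension (Assign 0 Empty)])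
     (Assign 0 (Lit 0))) (Assign 0 Empty))"

section \<open>Running time of the extension program\<close>

definition ext_arcs :: "nat list \<Rightarrow> nat list \<Rightarrow> nat \<Rightarrow> nat \<Rightarrow> nat list" where
  "ext_arcs vs as k N = rev [N + length vs * k..<N + 2 * (length vs * k)] @ rev [N..<N + length vs * k] @ as"

definition ext_query ::
  "(nat, nat) pre_digraph \<Rightarrow> (nat \<Rightarrow> real) \<Rightarrow> (nat \<Rightarrow> real) \<Rightarrow> nat list \<Rightarrow> nat list \<Rightarrow> nat \<Rightarrow> nat \<Rightarrow> nat \<Rightarrow> data" where
  "ext_query G c w vs as k r N = enc_list [enc_list (map enc_nat (r # vs)),
     enc_list (map (enc_arc G c w) (ext_arcs vs as k N)), enc_nat r, enc_nat k]"

text \<open>In the time bound, building both stars takes \<open>12 * n\<close>, and the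
  \<open>2 * n\<close> new arcs contribute \<open>24 * n\<close> to the size of the query.\<close>

lemma wp_query_extension:
  fixes G :: "(nat, nat) pre_digraph" and S W :: real and n r :: nat
  assumes s: "s 17 = enc_list (map enc_nat vs)" "s 2 = enc_nat k" "s 5 = Num S" "s 6 = Num W"
    "s 7 = enc_nat N" "s 13 = enc_list (map (enc_arc G c w) as)"
    and vs: "vs \<noteq> []" and N: "\<And>a. a \<in> set as \<Longrightarrow> a < N"
    and r: "r = Suc (sum_list vs)" and n: "n = length vs * k"
  defines "G2 \<equiv> ext_graph G vs k N r" and "c2 \<equiv> ext_fun c N n (2 * S) (S + n * (2 * S))"
    and "w2 \<equiv> ext_fun w N n 0 W"
  assumes f: "f (ext_query G2 c2 w2 vs as k r N) = enc_list (map enc_nat hs)"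
    and Q: "\<And>t s'. t \<le> 60 + 16 * length vs + 12 * length as + 36 * n + 5 * length hs \<Longrightarrow>
      s' 0 = enc_list (map enc_nat (rev (filter (\<lambda>h. h < N) hs))) \<Longrightarrow> Q t s'"
  shows "wp f query_extension Q s"
proof -
  have h1: "head G2 (N + j * k + i) = vs ! j" if "j < length vs" "i < k" for j i
    using that by (simp add: G2_def ext_graph_def add.assoc)
  have h2: "head G2 (N + n + j * k + i) = vs ! j" if "j < length vs" "i < k" for j i
  proof -
    have "(N + n + j * k + i - N) div k mod length vs = ((length vs + j) * k + i) div k mod length vs"
      by (simp add: n algebra_simps)
    also have "\<dots> = j" using that by simp
    finally show ?thesis by (simp add: G2_def ext_graph_def)
  qed
  have hd: "(case enc_list (map enc_nat vs) of Node a b \<Rightarrow> a | _ \<Rightarrow> Null) = enc_nat (hd vs)"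
    using vs by (cases vs) auto
  have old: "map (enc_arc G c w) as = map (enc_arc G2 c2 w2) as"
    using N by (auto simp: enc_arc_def G2_def c2_def w2_def ext_graph_def ext_fun_def)
  have pen: "map (\<lambda>a. arc_data a (hd vs) (head G2 a) (2 * S) 0) (rev [N..<N + n]) =
      map (enc_arc G2 c2 w2) (rev [N..<N + n])"
    by (auto simp: arc_data_def enc_arc_def G2_def c2_def w2_def ext_graph_def ext_fun_def n)
  have root: "map (\<lambda>a. arc_data a r (head G2 a) (S + n * (2 * S)) W) (rev [N + n..<N + 2 * n]) =
      map (enc_arc G2 c2 w2) (rev [N + n..<N + 2 * n])"
    by (auto simp: arc_data_def enc_arc_def G2_def c2_def w2_def ext_graph_def ext_fun_def n)
  \<comment> \<open>Arcs are put in front of the list one by one, root arcs last, which gives the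
    order in \<open>ext_arcs\<close>.\<close>
  have arcs: "map (\<lambda>a. arc_data a r (head G2 a) (S + n * (2 * S)) W) (rev [N + n..<N + n + n]) @
      map (\<lambda>a. arc_data a (hd vs) (head G2 a) (2 * S) 0) (rev [N..<N + n]) @ map (enc_arc G c w) as =
      map (enc_arc G2 c2 w2) (ext_arcs vs as k N)"
  proof -
    have "N + n + n = N + 2 * n" by simp
    then show ?thesis unfolding ext_arcs_def n[symmetric] map_append by (simp only: old pen root)
  qed
  have len: "length (ext_arcs vs as k N) = length as + 2 * n"
    by (simp add: ext_arcs_def n)
  have star1: "wp f add_star Q' s'" if
    "s' 3 = enc_list (map enc_nat vs)" "s' 2 = enc_nat k" "s' 14 = Num 0" "s' 7 = enc_nat N"
    "s' 9 = enc_nat (hd vs)" "s' 10 = Num (2 * S)" "s' 11 = Num 0" "s' 12 = Num S"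
    "s' 13 = enc_list (map (enc_arc G c w) as)"
    "\<And>t. t \<le> 1 + 5 * length vs + 6 * n \<Longrightarrow>
      Q' t (s'(3 := Null, 7 := enc_nat (N + n), 12 := Num (S + n * (2 * S)),
        13 := enc_list (map (\<lambda>a. arc_data a (hd vs) (head G2 a) (2 * S) 0) (rev [N..<N + n]) @
          map (enc_arc G c w) as)))" for Q' s'
  proof (rule wp_add_star[where h = "head G2", OF that(1-9) h1])
    fix t assume "t \<le> 1 + (5 + 6 * k) * length vs"
    then have "t \<le> 1 + 5 * length vs + 6 * n" by (simp add: n algebra_simps)
    from that(10)[OF this] show "Q' t (s'(3 := Null, 7 := enc_nat (N + length vs * k),
        12 := Num (S + (length vs * k) * (2 * S)),
        13 := enc_list (map (\<lambda>a. arc_data a (hd vs) (head G2 a) (2 * S) 0)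
          (rev [N..<N + length vs * k]) @ map (enc_arc G c w) as)))"
      by (simp add: n)
  qed
  have star2: "wp f add_star Q' s'" if
    "s' 3 = enc_list (map enc_nat vs)" "s' 2 = enc_nat k" "s' 14 = Num 0" "s' 7 = enc_nat (N + n)"
    "s' 9 = enc_nat r" "s' 10 = Num (S + n * (2 * S))" "s' 11 = Num W" "s' 12 = Num m"
    "s' 13 = enc_list (map (\<lambda>a. arc_data a (hd vs) (head G2 a) (2 * S) 0) (rev [N..<N + n]) @
          map (enc_arc G c w) as)"
    "\<And>t d m. t \<le> 1 + 5 * length vs + 6 * n \<Longrightarrow>
      Q' t (s'(3 := Null, 7 := d, 12 := m, 13 := enc_list (map (enc_arc G2 c2 w2) (ext_arcs vs as k N))))"
    for Q' s' m
  proof (rule wp_add_star[where h = "head G2", OF that(1-9) h2])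
    fix t assume "t \<le> 1 + (5 + 6 * k) * length vs"
    then have "t \<le> 1 + 5 * length vs + 6 * n" by (simp add: n algebra_simps)
    from that(10)[OF this] show "Q' t (s'(3 := Null, 7 := enc_nat (N + n + length vs * k),
        12 := Num (m + (length vs * k) * (S + n * (2 * S))),
        13 := enc_list (map (\<lambda>a. arc_data a r (head G2 a) (S + n * (2 * S)) W)
          (rev [N + n..<N + n + length vs * k]) @
          map (\<lambda>a. arc_data a (hd vs) (head G2 a) (2 * S) 0) (rev [N..<N + n]) @
          map (enc_arc G c w) as)))"
      by (simp only: n[symmetric] arcs)
  qed
  show ?thesis
    unfolding query_extension_def
    apply (simp add: s)
    apply (rule wp_scan_nodes[where vs = vs])
      apply (simp_all add: s hd r[symmetric])
    apply (rule star1)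
             apply (simp_all add: s)
    apply (rule star2)
             apply (simp_all add: s)
    apply (rule wp_keep_less[where hs = hs and N = N])
       apply (simp_all add: s f[unfolded ext_query_def, simplified])
    apply (rule Q)
     apply (simp_all add: len enc_nat_def)
    done
qed

section \<open>Optimality and degenerate instances\<close>

lemma optimal_unrooted_iff:
  "optimal blocking_union_arborescences (G, k, c, w) H \<longleftrightarrow>
    blocks_optimal G c (union_arborescence G k) H \<and>
    (\<forall>H'. blocks_optimal G c (union_arborescence G k) H' \<longrightarrow> sum w H \<le> sum w H')"
  by (simp add: optimal_def blocking_union_arborescences_def)

lemma optimal_rooted_iff:
  "optimal blocking_union_r_arborescences (G, r, k, c, w) H \<longleftrightarrow>
    blocks_optimal G c (union_r_arborescence G r k) H \<and>
    (\<forall>H'. blocks_optimal G c (union_r_arborescence G r k) H' \<longrightarrow> sum w H \<le> sum w H')"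
  by (simp add: optimal_def blocking_union_r_arborescences_def)

text \<open>Without a \<open>k\<close>-union-arborescence every set of arcs blocks vacuously, and
  the empty one has least weight as weights are nonnegative.\<close>

lemma correct_answer_Null:
  assumes "\<And>a. a \<in> arcs G \<Longrightarrow> w a \<ge> 0" "\<nexists>B. union_arborescence G k B"
  shows "correct_answer blocking_union_arborescences (G, k, c, w) Null"
proof -
  have "0 \<le> sum w H" if "H \<subseteq> arcs G" for H using assms(1) that by (intro sum_nonneg) auto
  then have "optimal blocking_union_arborescences (G, k, c, w) {}"
    using assms(2) by (auto simp: optimal_unrooted_iff blocks_optimal_def min_cost_def)
  moreover have "encodes_set {} Null" unfolding encodes_set_def by (intro exI[of _ "[]"]) simp
  ultimately show ?thesis unfolding correct_answer_def by auto
qed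

text \<open>All arcs enter the only node, which is the root, so the only
  \<open>k\<close>-union-arborescence is the empty set, and nothing intersects it.\<close>

lemma correct_answer_single_node:
  assumes G: "fin_digraph G" and v: "verts G = {v}"
  shows "correct_answer blocking_union_arborescences (G, k, c, w) (Num 0)"
proof -
  have "B = {}" if "spanning_arborescence G r B" for r B
  proof -
    have B: "B \<subseteq> arcs G" "r = v" "\<And>a. a \<in> B \<Longrightarrow> head G a \<noteq> r"
      using that v unfolding spanning_arborescence_iff[OF G] by auto
    have "head G a = v" if "a \<in> B" for a
      using B(1) that v wf_digraph.head_in_verts[OF fin_digraph.axioms(1)[OF G]] by blast
    then show ?thesis using B(2,3) by blast
  qed
  then have "B = {}" if "union_arborescence G k B" for B
    using that unfolding union_arborescence_def by blast
  then have "min_cost c (union_arborescence G k) {}"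
    using union_arborescence_trivial[OF G v] by (fastforce simp: min_cost_def)
  then have "\<not> blocks_optimal G c (union_arborescence G k) H" for H
    by (auto simp: blocks_optimal_def)
  then show ?thesis by (simp add: correct_answer_def optimal_unrooted_iff)
qed

lemma wp_unrooted_to_rooted:
  fixes G :: "(nat, nat) pre_digraph"
  assumes d: "d = enc_list [enc_list (map enc_nat vs), enc_list (map (enc_arc G c w) as), enc_nat k]"
    and vs: "vs = u # v # us"
    and rest: "\<And>t. t \<le> 20 + 8 * length as \<Longrightarrow>
      wp f (if k \<le> length as then query_extension else Assign 0 Empty) (\<lambda>t'. Q (t + t'))
        ((\<lambda>_. Null)(0 := d, 17 := enc_list (map enc_nat vs),
          13 := enc_list (map (enc_arc G c w) as), 2 := enc_nat k, 3 := Null, 4 := Num (length as),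
          5 := Num (1 + (\<Sum>a\<leftarrow>as. \<bar>c a\<bar>)), 6 := Num (1 + (\<Sum>a\<leftarrow>as. w a)),
          7 := enc_nat (Suc (sum_list as))))"
  shows "wp f unrooted_to_rooted Q ((\<lambda>_. Null)(0 := d))"
proof -
  have nodes: "enc_list (map enc_nat vs) \<noteq> Null"
    "(case enc_list (map enc_nat vs) of Node a b \<Rightarrow> b | _ \<Rightarrow> Null) \<noteq> Null"
    using vs by auto
  show ?thesis
    unfolding unrooted_to_rooted_def
    apply (simp add: d nodes)
    apply (rule wp_scan_arcs[where G = G and c = c and w = w and as = as])
         apply simp_all
    subgoal for t
      \<comment> \<open>The twelve units are eight assignments, three tests and the trailing
        \<open>Skip\<close>.\<close>
      using rest[of "Suc (Suc (Suc (Suc (Suc (Suc (Suc (Suc (Suc (Suc (Suc (Suc t)))))))))))"]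
      by (simp add: d enc_nat_def split: if_splits) (erule wp_mono, simp)
    done
qed

text \<open>The bound is quadratic because each star has \<open>length vs * k\<close> arcs, with
  \<open>k\<close> at most the number of given arcs whenever stars are built.\<close>

lemma unrooted_reducible_to_rooted:
  "poly_time_reducible blocking_union_arborescences blocking_union_r_arborescences"
proof (rule poly_time_reducibleI[where c = unrooted_to_rooted and p = "[:100, 50, 50:]"])
  fix f i d
  assume f: "solves f blocking_union_r_arborescences"
    and i: "i \<in> instances blocking_union_arborescences"
    and d: "encodes blocking_union_arborescences i d"
  let ?T = "poly [:100, 50, 50:] (data_size d)"
  let ?run = "\<lambda>y. wp f unrooted_to_rooted (\<lambda>t s'. t \<le> ?T \<and> s' 0 = y) ((\<lambda>_. Null)(0 := d))"
  obtain G k c w where i': "i = (G, k, c, w)" by (cases i)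
  then have G: "fin_digraph G" and k: "k > 0" and w: "\<And>a. a \<in> arcs G \<Longrightarrow> w a \<ge> 0"
    using i by (auto simp: blocking_union_arborescences_def)
  obtain vs as where vs: "distinct vs" "set vs = verts G" and as: "distinct as" "set as = arcs G"
    and d': "d = enc_list [enc_list (map enc_nat vs), enc_list (map (enc_arc G c w) as), enc_nat k]"
    using d i' by (auto simp: blocking_union_arborescences_def encodes_set_def encodes_arcs_def)
  have size: "length vs + length as \<le> data_size d" by (simp add: d')
  have T: "?T = 100 + 50 * data_size d + 50 * (data_size d * data_size d)"
    by (simp add: algebra_simps)
  consider "vs = []" | v where "vs = [v]" | (big) u v us where "vs = u # v # us"
    by (metis neq_Nil_conv)
  then have "\<exists>y. ?run y \<and> correct_answer blocking_union_arborescences i y"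
  proof cases
    case 1
    have "\<nexists>B. union_arborescence G k B"
      using k vs 1 by (auto simp: union_arborescence_def spanning_arborescence_def)
    then have "correct_answer blocking_union_arborescences i Null"
      unfolding i' using w by (intro correct_answer_Null)
    moreover have "?run Null" using 1 by (simp add: unrooted_to_rooted_def d')
    ultimately show ?thesis by blast
  next
    case 2
    then have "correct_answer blocking_union_arborescences i (Num 0)"
      unfolding i' using vs by (intro correct_answer_single_node[OF G]) auto
    moreover have "?run (Num 0)" using 2 by (simp add: unrooted_to_rooted_def d')
    ultimately show ?thesis by blast
  next
    case big
    define S where "S = 1 + (\<Sum>a\<leftarrow>as. \<bar>c a\<bar>)"
    define W where "W = 1 + (\<Sum>a\<leftarrow>as. w a)"
    define N where "N = Suc (sum_list as)"
    define s :: store where "s = (\<lambda>_. Null)(0 := d, 17 := enc_list (map enc_nat vs),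
      13 := enc_list (map (enc_arc G c w) as), 2 := enc_nat k, 3 := Null, 4 := Num (length as),
      5 := Num S, 6 := Num W, 7 := enc_nat N)"
    have run: "?run y" if
      "\<And>t. t \<le> 20 + 8 * length as \<Longrightarrow>
        wp f (if k \<le> length as then query_extension else Assign 0 Empty)
          (\<lambda>t' s'. t + t' \<le> ?T \<and> s' 0 = y) s" for y
      by (rule wp_unrooted_to_rooted[OF d' big that[unfolded s_def S_def W_def N_def]])
    show ?thesis
    proof (cases "k \<le> length as")
      case False
      have "card (arcs G) = length as" using as by (metis distinct_card)
      then have "\<nexists>B. union_arborescence G k B"
        using union_arborescence_card[OF G, of k _ u v] union_arborescence_subset[of G k]
          card_mono[OF fin_digraph.finite_arcs[OF G]] vs big False
        by (metis distinct_length_2_or_more le_trans list.set_intros)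
      then have "correct_answer blocking_union_arborescences i Null"
        unfolding i' using w by (intro correct_answer_Null)
      moreover have "?run Null"
      proof (rule run)
        fix t assume "t \<le> 20 + 8 * length as"
        then have "t + 1 \<le> ?T" using size T by linarith
        then show "wp f (if k \<le> length as then query_extension else Assign 0 Empty)
          (\<lambda>t' s'. t + t' \<le> ?T \<and> s' 0 = Null) s"
          using False by (simp del: poly_pCons)
      qed
      ultimately show ?thesis by blast
    next
      case True
      define r where "r = Suc (sum_list vs)"
      define n where "n = length vs * k"
      define G2 where "G2 = ext_graph G vs k N r"
      define c2 where "c2 = ext_fun c N n (2 * S) (S + n * (2 * S))"
      define w2 where "w2 = ext_fun w N n 0 W"
      define q where "q = ext_query G2 c2 w2 vs as k r N"
      have N: "a < N" if "a \<in> arcs G" for a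
        using that as member_le_sum_list[of a as] by (auto simp: N_def)
      have r: "r \<notin> verts G"
        using vs member_le_sum_list[of r vs] by (auto simp: r_def)
      have sums: "S = 1 + (\<Sum>a\<in>arcs G. \<bar>c a\<bar>)" "W = 1 + (\<Sum>a\<in>arcs G. w a)"
        using as by (simp_all add: S_def W_def sum_list_distinct_conv_sum_set)
      have len: "length vs \<ge> 2" using big by simp
      \<comment> \<open>The summand one in \<open>S\<close> and \<open>W\<close> makes these
        inequalities strict.\<close>
      have L: "2 * S > 2 * (\<Sum>a\<in>arcs G. \<bar>c a\<bar>)" and W: "W > (\<Sum>a\<in>arcs G. w a)"
        and M: "S + real n * (2 * S) > (2 * S) * real (length vs * k) + (\<Sum>a\<in>arcs G. \<bar>c a\<bar>)"
        unfolding n_def sums by (simp_all add: mult.commute)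
      obtain pen root where "root_extension G G2 r (hd vs) k pen root c c2 w w2
          (2 * S) (S + n * (2 * S)) {N..<N + n} {N + n..<N + 2 * n}"
        using root_extension_ext_graph[OF G vs len k r N w L M W]
        unfolding G2_def c2_def w2_def n_def by blast
      then interpret root_extension G G2 r "hd vs" k pen root c c2 w w2
          "2 * S" "S + n * (2 * S)" "{N..<N + n}" "{N + n..<N + 2 * n}" .
      let ?j = "(G2, r, k, c2, w2)"
      have "?j \<in> instances blocking_union_r_arborescences"
        using G2 k w2_nonneg by (auto simp: blocking_union_r_arborescences_def verts2)
      moreover have "encodes blocking_union_r_arborescences ?j q"
      proof -
        have "distinct (r # vs)" "set (r # vs) = verts G2" using vs r by (auto simp: verts2)
        moreover have "distinct (ext_arcs vs as k N)" "set (ext_arcs vs as k N) = arcs G2"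
          using as N by (auto simp: ext_arcs_def arcs2 n_def dest: N)
        ultimately show ?thesis
          unfolding q_def ext_query_def blocking_union_r_arborescences_def encodes_set_def encodes_arcs_def
          by (simp del: set_simps distinct.simps list.map enc_list.simps) blast
      qed
      ultimately have ans: "correct_answer blocking_union_r_arborescences ?j (f q)"
        using f unfolding solves_def by blast
      \<comment> \<open>The extension always has a minimum blocker, so the oracle's answer encodes a
        set and is not the report \<open>Num 0\<close>.\<close>
      have "\<exists>H. optimal blocking_union_r_arborescences ?j H"
        using ex_minimum_blocker unfolding optimal_rooted_iff by metis
      then obtain H where H: "optimal blocking_union_r_arborescences ?j H" "encodes_set H (f q)"
        using ans unfolding correct_answer_def by auto
      obtain hs where hs: "distinct hs" "set hs = H" "f q = enc_list (map enc_nat hs)"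
        using H(2) unfolding encodes_set_def by blast
      have HG: "H \<subseteq> arcs G2" using H(1) by (auto simp: optimal_rooted_iff blocks_optimal_def)
      \<comment> \<open>Among the arcs of \<open>G2\<close>, exactly those of \<open>G\<close> have
        names below \<open>N\<close>.\<close>
      define ys where "ys = rev (filter (\<lambda>h. h < N) hs)"
      have "distinct ys" "set ys = H \<inter> arcs G"
        using hs HG N by (auto simp: ys_def arcs2)
      then have "encodes_set (H \<inter> arcs G) (enc_list (map enc_nat ys))"
        unfolding encodes_set_def by blast
      moreover have "optimal blocking_union_arborescences i (H \<inter> arcs G)"
        using minimum_blocker_restrict H(1) unfolding i' optimal_rooted_iff optimal_unrooted_iff by blast
      ultimately have "correct_answer blocking_union_arborescences i (enc_list (map enc_nat ys))"
        unfolding correct_answer_def by auto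
      moreover have "?run (enc_list (map enc_nat ys))"
      proof (rule run)
        fix t assume t: "t \<le> 20 + 8 * length as"
        have "length hs \<le> card (arcs G2)"
          using hs HG card_mono[OF fin_digraph.finite_arcs[OF G2]] distinct_card by metis
        also have "\<dots> \<le> card (arcs G) + n + n"
          unfolding arcs2 by (intro order_trans[OF card_Un_le] add_mono) auto
        also have "card (arcs G) = length as" using as by (metis distinct_card)
        finally have len: "length hs \<le> length as + n + n" .
        have "n \<le> data_size d * data_size d"
          unfolding n_def using True size by (intro mult_mono) auto
        then have bound: "80 + 16 * length vs + 20 * length as + 36 * n + 5 * length hs \<le> ?T"
          using len size T by linarith
        have "wp f query_extension (\<lambda>t' s'. t + t' \<le> ?T \<and> s' 0 = enc_list (map enc_nat ys)) s"
        proof (rule wp_query_extension[where hs = hs])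
          show "f (ext_query (ext_graph G vs k N r) (ext_fun c N n (2 * S) (S + n * (2 * S)))
              (ext_fun w N n 0 W) vs as k r N) = enc_list (map enc_nat hs)"
            using hs(3) unfolding q_def G2_def c2_def w2_def .
          show "t + t' \<le> ?T \<and> s' 0 = enc_list (map enc_nat ys)"
            if "t' \<le> 60 + 16 * length vs + 12 * length as + 36 * n + 5 * length hs"
              "s' 0 = enc_list (map enc_nat (rev (filter (\<lambda>h. h < N) hs)))" for t' s'
            using that t bound unfolding ys_def by linarith
        qed (use big as N in \<open>auto simp: s_def r_def n_def\<close>)
        then show "wp f (if k \<le> length as then query_extension else Assign 0 Empty)
          (\<lambda>t' s'. t + t' \<le> ?T \<and> s' 0 = enc_list (map enc_nat ys)) s" using True by simp
      qed
      ultimately show ?thesis by blast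
    qed
  qed
  then show "\<exists>y. ?run y \<and> correct_answer blocking_union_arborescences i y" .
qed

theorem theorem1:
  shows "poly_time_equivalent blocking_union_arborescences blocking_union_r_arborescences"
  unfolding poly_time_equivalent_def
  using unrooted_reducible_to_rooted rooted_reducible_to_unrooted by blast

end
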